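(* Let $F:[0,1]^{N+1}\to\mathbb{R}$ satisfy Assumption (A) stated in the context. Consider solutions $(c,(\phi_1,\phi_2))$, with $c\in\mathbb{R}$ and $\phi_1,\phi_2:\mathbb{R}\to[0,1]$, of $$\begin{cases} c\,\phi_1'(z)=\alpha_0(\phi_2(z)-\phi_1(z)),\\ c\,\phi_2'(z)=2F((\phi_1(z+r_i))_{i=0,\dots,N})+\alpha_0(\phi_1(z)-\phi_2(z)),\\ \phi_1(-\infty)=0,\quad\phi_1(+\infty)=1,\\ \phi_2(-\infty)=0,\quad\phi_2(+\infty)=1. \end{cases}$$ (a) (Uniqueness of the velocity) If $F$ satisfies in addition Assumption (C), then the velocity $c$ is unique: if $(c,(\phi_1,\phi_2))$ and $(\tilde c,(\tilde\phi_1,\tilde\phi_2))$ are two solutions, then $c=\tilde c$. (b) (Uniqueness of the profile) Let $(c,(\phi_1,\phi_2))$ be a solution with $c\ne0$. Assume in addition (C), and, if $c>0$, (D+) i) or (D+) ii) (respectively, if $c<0$, (D−) i) or (D−) ii)). Then $(\phi_1,\phi_2)$ is unique up to translation (for any other solution $(c,(\tilde\phi_1,\tilde\phi_2))$ there is $a\in\mathbb{R}$ with $\tilde\phi_i=\phi_i(\cdot+a)$ for $i=1,2$), and $\phi_1$ and $\phi_2$ are (strictly) increasing.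
   Context: Standing data: $\alpha_0>0$; $N\ge1$ an integer; $r_0=0$ and $r_1,\dots,r_N\in\mathbb{R}$, with $r^*=\max_{i}|r_i|>0$. $\phi_i(\pm\infty)$ denotes the limit at $\pm\infty$. Assumption (A): $F$ is globally Lipschitz continuous over $[0,1]^{N+1}$; $F(X_0,\dots,X_N)$ is non-decreasing in $X_i$ for each $i\ne0$; and $2\frac{\partial F}{\partial X_0}+\alpha_0>0$ (at every point where this partial derivative exists). Assumption (C): there exists $\beta_0>0$ such that for all $a>0$: $F(X+(a,\dots,a))<F(X)$ for all $X$ with $X,\,X+(a,\dots,a)\in[0,\beta_0]^{N+1}$, and $F(X+(a,\dots,a))<F(X)$ for all $X$ with $X,\,X+(a,\dots,a)\in[1-\beta_0,1]^{N+1}$. Assumption (D+): i) $r_i\le0$ for all $i\in\{0,\dots,N\}$; ii) there is an index $i^+$ with $r_{i^+}>0$ such that $F$ is (strictly) increasing in $X_{i^+}$. Assumption (D−): i) $r_i\ge0$ for all $i\in\{0,\dots,N\}$; ii) there is an index $i^-$ with $r_{i^-}<0$ such that $F$ is (strictly) increasing in $X_{i^-}$. Solutions are understood in the viscosity sense. For locally bounded $u$, $u^*(y)=\limsup_{x\to y}u(x)$ and $u_*(y)=\liminf_{x\to y}u(x)$ are the upper and lower semi-continuous envelopes. A pair $(u_1,u_2)$ of locally bounded upper semi-continuous functions is a sub-solution of the two differential equations on an open set $\Omega\subset\mathbb{R}$ if for every $\psi\in C^1(\Omega)$: whenever $u_1-\psi$ has a local maximum at $z\in\Omega$, $c\psi'(z)\le\alpha_0(u_2(z)-u_1(z))$;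 and whenever $u_2-\psi$ has a local maximum at $z\in\Omega$, $c\psi'(z)\le2F((u_1(z+r_i))_{i=0,\dots,N})+\alpha_0(u_1(z)-u_2(z))$. Super-solutions are defined with lower semi-continuous functions, local minima and reversed inequalities. A locally bounded pair $(u_1,u_2)$ is a viscosity solution if $(u_1^*,u_2^* )$ is a sub-solution and $((u_1)_*,(u_2)_* )$ is a super-solution (here on $\Omega=\mathbb{R}$).
   Formalization: In (b) both solutions are assumed continuous: otherwise, with the envelope definition, mixing an increasing wave φ(z) on the rationals with φ(z+1) on the irrationals gives a solution with the same c that is neither monotone nor a translate. *)

theory Defs
  imports "HOL-Analysis.Analysis"
begin

text \<open>
  The indices \<open>0, ..., N\<close> are the elements of a finite type \<open>'n\<close> with a distinguished element
  \<open>0 :: 'n\<close>; the class \<open>zero\<close> is used only to name that element and carries no axioms. The cube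
  \<open>[0,1]^(N+1)\<close> is the order interval \<open>{0..1}\<close> of \<open>real ^ 'n\<close>. The nonlinearity \<open>F\<close> is a total
  function, but only its values on this cube are ever constrained or used.
\<close>

definition vec_upd :: "real ^ 'n \<Rightarrow> 'n \<Rightarrow> real \<Rightarrow> real ^ 'n" where
  "vec_upd X i t = (\<chi> j. if j = i then t else X $ j)"

text \<open>
  The partial derivative in \<open>X_0\<close> is the two-sided one, so it is only considered where
  \<open>0 < X_0 < 1\<close>; the other coordinates may lie on the boundary of the cube.
\<close>

definition assumption_A :: "real \<Rightarrow> (real ^ 'n::{finite,zero} \<Rightarrow> real) \<Rightarrow> bool" where
  "assumption_A \<alpha>\<^sub>0 F \<longleftrightarrow>
     (\<exists>L. L-lipschitz_on {0..1} F) \<and>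
     (\<forall>i. i \<noteq> 0 \<longrightarrow> (\<forall>X\<in>{0..1}. mono_on {0..1} (\<lambda>t. F (vec_upd X i t)))) \<and>
     (\<forall>X\<in>{0..1}. \<forall>D. 0 < X $ 0 \<and> X $ 0 < 1 \<and>
        ((\<lambda>t. F (vec_upd X 0 t)) has_real_derivative D) (at (X $ 0)) \<longrightarrow> 2 * D + \<alpha>\<^sub>0 > 0)"

text \<open>The bound \<open>\<beta> \<le> 1\<close> expresses that both small cubes lie in the domain of \<open>F\<close>.\<close>

definition assumption_C :: "(real ^ 'n::finite \<Rightarrow> real) \<Rightarrow> bool" where
  "assumption_C F \<longleftrightarrow>
     (\<exists>\<beta>>0. \<beta> \<le> 1 \<and>
       (\<forall>a>0.
         (\<forall>X. X \<in> {0..vec \<beta>} \<and> X + vec a \<in> {0..vec \<beta>} \<longrightarrow> F (X + vec a) < F X) \<and>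
         (\<forall>X. X \<in> {vec (1 - \<beta>)..1} \<and> X + vec a \<in> {vec (1 - \<beta>)..1} \<longrightarrow> F (X + vec a) < F X)))"

definition strictly_increasing_in :: "(real ^ 'n::finite \<Rightarrow> real) \<Rightarrow> 'n \<Rightarrow> bool" where
  "strictly_increasing_in F i \<longleftrightarrow>
     (\<forall>X\<in>{0..1}. strict_mono_on {0..1} (\<lambda>t. F (vec_upd X i t)))"

definition Dplus_i :: "('n \<Rightarrow> real) \<Rightarrow> bool" where
  "Dplus_i r \<longleftrightarrow> (\<forall>i. r i \<le> 0)"

definition Dplus_ii :: "('n::finite \<Rightarrow> real) \<Rightarrow> (real ^ 'n \<Rightarrow> real) \<Rightarrow> bool" where
  "Dplus_ii r F \<longleftrightarrow> (\<exists>i. r i > 0 \<and> strictly_increasing_in F i)"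

definition Dminus_i :: "('n \<Rightarrow> real) \<Rightarrow> bool" where
  "Dminus_i r \<longleftrightarrow> (\<forall>i. r i \<ge> 0)"

definition Dminus_ii :: "('n::finite \<Rightarrow> real) \<Rightarrow> (real ^ 'n \<Rightarrow> real) \<Rightarrow> bool" where
  "Dminus_ii r F \<longleftrightarrow> (\<exists>i. r i < 0 \<and> strictly_increasing_in F i)"

definition locally_bounded :: "(real \<Rightarrow> real) \<Rightarrow> bool" where
  "locally_bounded u \<longleftrightarrow> (\<forall>z. Bfun u (nhds z))"

definition usc :: "(real \<Rightarrow> real) \<Rightarrow> bool" where
  "usc u \<longleftrightarrow> (\<forall>z b. u z < b \<longrightarrow> (\<forall>\<^sub>F x in nhds z. u x < b))"

definition lsc :: "(real \<Rightarrow> real) \<Rightarrow> bool" where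
  "lsc u \<longleftrightarrow> (\<forall>z b. b < u z \<longrightarrow> (\<forall>\<^sub>F x in nhds z. b < u x))"

text \<open>
  In the semicontinuous envelopes the point \<open>y\<close> itself is included in the limit \<open>x \<rightarrow> y\<close>
  (filter \<open>nhds\<close>, not \<open>at\<close>), so that \<open>lower_env u \<le> u \<le> upper_env u\<close>. For locally bounded \<open>u\<close>
  the extended-real limits are finite.
\<close>

definition upper_env :: "(real \<Rightarrow> real) \<Rightarrow> real \<Rightarrow> real" where
  "upper_env u y = real_of_ereal (Limsup (nhds y) (\<lambda>x. ereal (u x)))"

definition lower_env :: "(real \<Rightarrow> real) \<Rightarrow> real \<Rightarrow> real" where
  "lower_env u y = real_of_ereal (Liminf (nhds y) (\<lambda>x. ereal (u x)))"

definition local_max_at :: "(real \<Rightarrow> real) \<Rightarrow> real \<Rightarrow> bool" where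
  "local_max_at f z \<longleftrightarrow> (\<forall>\<^sub>F x in nhds z. f x \<le> f z)"

definition local_min_at :: "(real \<Rightarrow> real) \<Rightarrow> real \<Rightarrow> bool" where
  "local_min_at f z \<longleftrightarrow> (\<forall>\<^sub>F x in nhds z. f z \<le> f x)"

definition visc_subsolution ::
  "real \<Rightarrow> ('n::finite \<Rightarrow> real) \<Rightarrow> (real ^ 'n \<Rightarrow> real) \<Rightarrow> real \<Rightarrow> real set \<Rightarrow>
   (real \<Rightarrow> real) \<Rightarrow> (real \<Rightarrow> real) \<Rightarrow> bool" where
  "visc_subsolution \<alpha>\<^sub>0 r F c \<Omega> u1 u2 \<longleftrightarrow>
     locally_bounded u1 \<and> locally_bounded u2 \<and> usc u1 \<and> usc u2 \<and>
     (\<forall>\<psi>. \<psi> C1_differentiable_on \<Omega> \<longrightarrow>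
       (\<forall>z\<in>\<Omega>.
         (local_max_at (\<lambda>x. u1 x - \<psi> x) z \<longrightarrow>
            c * deriv \<psi> z \<le> \<alpha>\<^sub>0 * (u2 z - u1 z)) \<and>
         (local_max_at (\<lambda>x. u2 x - \<psi> x) z \<longrightarrow>
            c * deriv \<psi> z \<le> 2 * F (\<chi> i. u1 (z + r i)) + \<alpha>\<^sub>0 * (u1 z - u2 z))))"

definition visc_supersolution ::
  "real \<Rightarrow> ('n::finite \<Rightarrow> real) \<Rightarrow> (real ^ 'n \<Rightarrow> real) \<Rightarrow> real \<Rightarrow> real set \<Rightarrow>
   (real \<Rightarrow> real) \<Rightarrow> (real \<Rightarrow> real) \<Rightarrow> bool" where
  "visc_supersolution \<alpha>\<^sub>0 r F c \<Omega> u1 u2 \<longleftrightarrow>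
     locally_bounded u1 \<and> locally_bounded u2 \<and> lsc u1 \<and> lsc u2 \<and>
     (\<forall>\<psi>. \<psi> C1_differentiable_on \<Omega> \<longrightarrow>
       (\<forall>z\<in>\<Omega>.
         (local_min_at (\<lambda>x. u1 x - \<psi> x) z \<longrightarrow>
            c * deriv \<psi> z \<ge> \<alpha>\<^sub>0 * (u2 z - u1 z)) \<and>
         (local_min_at (\<lambda>x. u2 x - \<psi> x) z \<longrightarrow>
            c * deriv \<psi> z \<ge> 2 * F (\<chi> i. u1 (z + r i)) + \<alpha>\<^sub>0 * (u1 z - u2 z))))"

definition visc_solution ::
  "real \<Rightarrow> ('n::finite \<Rightarrow> real) \<Rightarrow> (real ^ 'n \<Rightarrow> real) \<Rightarrow> real \<Rightarrow> real set \<Rightarrow>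
   (real \<Rightarrow> real) \<Rightarrow> (real \<Rightarrow> real) \<Rightarrow> bool" where
  "visc_solution \<alpha>\<^sub>0 r F c \<Omega> u1 u2 \<longleftrightarrow>
     locally_bounded u1 \<and> locally_bounded u2 \<and>
     visc_subsolution \<alpha>\<^sub>0 r F c \<Omega> (upper_env u1) (upper_env u2) \<and>
     visc_supersolution \<alpha>\<^sub>0 r F c \<Omega> (lower_env u1) (lower_env u2)"

definition travelling_wave ::
  "real \<Rightarrow> ('n::finite \<Rightarrow> real) \<Rightarrow> (real ^ 'n \<Rightarrow> real) \<Rightarrow> real \<Rightarrow>
   (real \<Rightarrow> real) \<Rightarrow> (real \<Rightarrow> real) \<Rightarrow> bool" where
  "travelling_wave \<alpha>\<^sub>0 r F c \<phi>1 \<phi>2 \<longleftrightarrow>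
     range \<phi>1 \<subseteq> {0..1} \<and> range \<phi>2 \<subseteq> {0..1} \<and>
     visc_solution \<alpha>\<^sub>0 r F c UNIV \<phi>1 \<phi>2 \<and>
     (\<phi>1 \<longlongrightarrow> 0) at_bot \<and> (\<phi>1 \<longlongrightarrow> 1) at_top \<and>
     (\<phi>2 \<longlongrightarrow> 0) at_bot \<and> (\<phi>2 \<longlongrightarrow> 1) at_top"

text \<open>
  Profiles of nonzero velocity are compared pointwise, which only makes sense for continuous
  ones: the envelope definition of a viscosity solution is blind to how a function jumps between
  its two envelopes. If \<open>(p1, p2)\<close> is a smooth increasing wave, then the pair equal to
  \<open>(p1 z, p2 z)\<close> for rational \<open>z\<close> and to \<open>(p1 (z + 1), p2 (z + 1))\<close> for irrational \<open>z\<close> satisfies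
  \<open>travelling_wave\<close> as well, but is neither monotone nor a translate of \<open>(p1, p2)\<close>.
\<close>

definition continuous_wave ::
  "real \<Rightarrow> ('n::finite \<Rightarrow> real) \<Rightarrow> (real ^ 'n \<Rightarrow> real) \<Rightarrow> real \<Rightarrow>
   (real \<Rightarrow> real) \<Rightarrow> (real \<Rightarrow> real) \<Rightarrow> bool" where
  "continuous_wave \<alpha>\<^sub>0 r F c \<phi>1 \<phi>2 \<longleftrightarrow>
     travelling_wave \<alpha>\<^sub>0 r F c \<phi>1 \<phi>2 \<and> continuous_on UNIV \<phi>1 \<and> continuous_on UNIV \<phi>2"

end

theory Submission
  imports Defs
begin

text \<open>
  A Lipschitz function of one variable is differentiable almost everywhere, so (A) makes
  \<open>H(X) = 2 F(X) + \<alpha>\<^sub>0 X_0\<close> monotone, and strictly monotone in \<open>X_0\<close>: the right-hand sides of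
  the system are non-decreasing in everything but the unknown being differentiated.

  Velocity. For a sub-solution \<open>u\<close> of velocity \<open>c\<close> and a super-solution \<open>v\<close> of velocity
  \<open>c' < c\<close>, the variables are doubled with a function of the shift \<open>y - x\<close> alone, i.e. the quotient
  \<open>(u\<^sub>i x - v\<^sub>i y) / \<theta> (y - x)\<close> is maximised. Both functions are then tested with the same positive
  slope, and since the non-local terms involve the same shift they are controlled by the maximum; no
  regularity is needed.

  Profile. For \<open>c \<noteq> 0\<close> continuous viscosity solutions are classical. One wave is slid over another:
  by (C) a positive maximum of the difference cannot lie in the tails, so at the critical shift the
  two waves touch, and under (D+) or (D-) touching waves coincide. The case \<open>c < 0\<close> is reduced to
  \<open>c > 0\<close> by the reflection \<open>z \<mapsto> - z\<close>.
\<close>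

section \<open>Differentiability of Lipschitz functions almost everywhere\<close>

text \<open>The sign condition in (A) speaks only where the derivative exists. It still gives
  monotonicity because a Lipschitz function sends the exceptional null set to a null set of values,
  which a suitable level avoids.

  Velocity: \<open>c = 0\<close> is allowed and waves may jump, so only envelopes can be compared
  and the two doubled points cannot be brought together. A test function of the shift needs no
  closeness: \<open>x + r i\<close> and \<open>y + r i\<close> have the same shift as
  \<open>x\<close> and \<open>y\<close>. (C) helps only if \<open>x\<close> is far to the left or
  \<open>y\<close> far to the right, and a large shift \<open>y - x\<close> forces one of the two.

  Profile: for \<open>c > 0\<close> the second equation is a damped transport, and contact of two
  ordered waves spreads to the left by itself. Spreading to the right is what (D+) supplies. Under
  i) the system only looks back, so it is a delay equation, determined forward by its past; under
  ii) strictness in a coordinate with \<open>r i > 0\<close> makes contact jump ahead by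
  \<open>r i\<close>.\<close>

lemma increasing_image_cover:
  fixes f :: "real \<Rightarrow> real"
  assumes mono: "strict_mono f" and lip: "\<And>x y. \<bar>f y - f x\<bar> \<le> B * \<bar>y - x\<bar>"
    and U: "open U" "E \<subseteq> U" and p: "p \<ge> 0"
    and cov: "\<And>x d. x \<in> E \<Longrightarrow> d > 0 \<Longrightarrow> \<exists>y. y \<noteq> x \<and> \<bar>y - x\<bar> < d \<and> \<bar>f y - f x\<bar> \<le> p * \<bar>y - x\<bar>"
  shows "\<exists>V \<in> sets lebesgue. f ` E \<subseteq> V \<and> emeasure lebesgue V \<le> ennreal p * emeasure lebesgue U"
proof -
  define lo hi where "lo = (\<lambda>(x, y). min x (y::real))" and "hi = (\<lambda>(x, y). max x (y::real))"
  define K where "K = {(x, y). x \<in> E \<and> y \<noteq> x \<and> {min x y..max x y} \<subseteq> U \<and> \<bar>f y - f x\<bar> \<le> p * \<bar>y - x\<bar>}"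
  have lohi: "lo i < hi i" "{lo i..hi i} \<subseteq> U" "f (hi i) - f (lo i) \<le> p * (hi i - lo i)" if "i \<in> K" for i
  proof -
    obtain x y where i: "i = (x, y)" "y \<noteq> x" "{min x y..max x y} \<subseteq> U" "\<bar>f y - f x\<bar> \<le> p * \<bar>y - x\<bar>"
      using \<open>i \<in> K\<close> by (auto simp: K_def)
    have "f (max x y) - f (min x y) \<le> \<bar>f y - f x\<bar>" "max x y - min x y = \<bar>y - x\<bar>" "min x y < max x y"
      using i(2) by (auto simp: min_def max_def)
    then show "lo i < hi i" "{lo i..hi i} \<subseteq> U" "f (hi i) - f (lo i) \<le> p * (hi i - lo i)"
      using i by (auto simp: lo_def hi_def)
  qed
  have cb: "cball ((lo i + hi i) / 2) ((hi i - lo i) / 2) = {lo i..hi i}" for i :: "real \<times> real"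
    by (simp add: cball_eq_atLeastAtMost field_simps)
  have "\<exists>i. i \<in> K \<and> x \<in> cball ((lo i + hi i) / 2) ((hi i - lo i) / 2) \<and> (hi i - lo i) / 2 < d"
    if x: "x \<in> E" and d: "0 < d" for x d
  proof -
    obtain e where e: "e > 0" "cball x e \<subseteq> U"
      using U x open_contains_cball by (metis subsetD)
    obtain y where y: "y \<noteq> x" "\<bar>y - x\<bar> < min d e" "\<bar>f y - f x\<bar> \<le> p * \<bar>y - x\<bar>"
      using cov[OF x, of "min d e"] d e by auto
    have "{min x y..max x y} \<subseteq> cball x e"
      using y by (auto simp: dist_real_def min_def max_def abs_if split: if_splits)
    then have "(x, y) \<in> K" using e y x by (auto simp: K_def)
    have "hi (x, y) - lo (x, y) = \<bar>y - x\<bar>" by (simp add: lo_def hi_def min_def max_def)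
    moreover have "\<bar>y - x\<bar> < d" using y(2) by simp
    then have "\<bar>y - x\<bar> / 2 < d" by simp
    ultimately have "(hi (x, y) - lo (x, y)) / 2 < d" by simp
    moreover have "x \<in> {lo (x, y)..hi (x, y)}" by (auto simp: lo_def hi_def)
    ultimately show ?thesis using \<open>(x, y) \<in> K\<close> unfolding cb by blast
  qed
  \<comment> \<open>Vitali selects disjoint intervals that cover \<open>E\<close> up to a null set.
    Disjointness is what later bounds their total length by the measure of \<open>U\<close>.\<close>
  then obtain C where C: "countable C" "C \<subseteq> K"
     "pairwise (\<lambda>i j. disjnt (cball ((lo i + hi i) / 2) ((hi i - lo i) / 2)) (cball ((lo j + hi j) / 2) ((hi j - lo j) / 2))) C"
     "negligible (E - (\<Union>i \<in> C. cball ((lo i + hi i) / 2) ((hi i - lo i) / 2)))"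
    by (rule Vitali_covering_theorem_cballs[of K "\<lambda>i. (hi i - lo i) / 2", rotated]) (auto dest: lohi)
  define N where "N = E - (\<Union>i \<in> C. {lo i..hi i})"
  have N: "negligible N" using C(4) by (simp add: N_def cb)
  have dis: "disjnt {lo i..hi i} {lo j..hi j}" if "i \<in> C" "j \<in> C" "i \<noteq> j" for i j
    using C(3) that unfolding cb pairwise_def by blast
  \<comment> \<open>The Lipschitz bound takes care of the points that the intervals miss: their
    image is null as well.\<close>
  have fN: "negligible (f ` N)"
  proof (rule negligible_locally_Lipschitz_image[OF _ N])
    show "\<exists>T B. open T \<and> x \<in> T \<and> (\<forall>y\<in>N \<inter> T. norm (f y - f x) \<le> B * norm (y - x))" for x
      using lip by (intro exI[of _ UNIV] exI[of _ B]) auto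
  qed auto
  have f_mono: "f x \<le> f y \<longleftrightarrow> x \<le> y" for x y using strict_mono_less_eq[OF mono] .
  have f_less: "f x < f y \<longleftrightarrow> x < y" for x y using strict_mono_less[OF mono] .
  have disf: "disjoint_family_on (\<lambda>i. {f (lo i)..f (hi i)}) C"
    unfolding disjoint_family_on_def
  proof (intro ballI impI)
    fix i j assume ij: "i \<in> C" "j \<in> C" "i \<noteq> j"
    have "hi i < lo j \<or> hi j < lo i"
    proof (rule ccontr)
      assume "\<not> ?thesis"
      then have "max (lo i) (lo j) \<in> {lo i..hi i} \<inter> {lo j..hi j}"
        using lohi(1)[of i] lohi(1)[of j] ij C(2) by (auto simp: max_def)
      then show False using dis[OF ij] by (auto simp: disjnt_def)
    qed
    then have "f (hi i) < f (lo j) \<or> f (hi j) < f (lo i)" by (simp add: f_less)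
    then show "{f (lo i)..f (hi i)} \<inter> {f (lo j)..f (hi j)} = {}" by auto
  qed
  define V where "V = (\<Union>i\<in>C. {f (lo i)..f (hi i)}) \<union> f ` N"
  have V1: "(\<Union>i\<in>C. {f (lo i)..f (hi i)}) \<in> sets lebesgue"
    using C(1) by (intro sets.countable_UN') auto
  have "emeasure lebesgue V = emeasure lebesgue (\<Union>i\<in>C. {f (lo i)..f (hi i)})"
    unfolding V_def using fN V1 by (intro emeasure_Un_null_set) (auto simp: negligible_iff_null_sets)
  also have "\<dots> = (\<integral>\<^sup>+i. emeasure lebesgue {f (lo i)..f (hi i)} \<partial>count_space C)"
    using C(1) disf by (intro emeasure_UN_countable) auto
  also have "\<dots> \<le> (\<integral>\<^sup>+i. ennreal p * emeasure lebesgue {lo i..hi i} \<partial>count_space C)"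
  proof (rule nn_integral_mono)
    fix i assume "i \<in> space (count_space C)"
    then have i: "i \<in> K" using C by auto
    have "f (lo i) \<le> f (hi i)" using lohi(1)[OF i] by (simp add: f_mono)
    then show "emeasure lebesgue {f (lo i)..f (hi i)} \<le> ennreal p * emeasure lebesgue {lo i..hi i}"
      using lohi(1,3)[OF i] p by (simp add: ennreal_mult[symmetric] ennreal_leI)
  qed
  also have "\<dots> = ennreal p * (\<integral>\<^sup>+i. emeasure lebesgue {lo i..hi i} \<partial>count_space C)"
    by (rule nn_integral_cmult) simp
  also have "(\<integral>\<^sup>+i. emeasure lebesgue {lo i..hi i} \<partial>count_space C) = emeasure lebesgue (\<Union>i\<in>C. {lo i..hi i})"
    using C(1) dis by (intro emeasure_UN_countable[symmetric]) (auto simp: disjoint_family_on_def disjnt_def)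
  also have "\<dots> \<le> emeasure lebesgue U"
  proof (rule emeasure_mono)
    show "(\<Union>i\<in>C. {lo i..hi i}) \<subseteq> U" using C(2) lohi(2) by blast
    show "U \<in> sets lebesgue" using U(1) by (metis borel_open sets_completionI_sets sets_lborel)
  qed
  finally have "emeasure lebesgue V \<le> ennreal p * emeasure lebesgue U" by (simp add: mult_left_mono)
  moreover have "V \<in> sets lebesgue"
    using V1 fN by (auto simp: V_def negligible_imp_sets)
  moreover have "f ` E \<subseteq> V"
  proof
    fix z assume "z \<in> f ` E"
    then obtain x where x: "x \<in> E" "z = f x" by blast
    show "z \<in> V"
    proof (cases "x \<in> N")
      case False
      then obtain i where "i \<in> C" "lo i \<le> x" "x \<le> hi i" using x by (auto simp: N_def)
      then show ?thesis unfolding V_def x by (auto simp: f_mono)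
    qed (auto simp: V_def x)
  qed
  ultimately show ?thesis by blast
qed

text \<open>The covering set given by the hypothesis need not be open. Outer regularity enlarges it
  to an open set at the price of a slightly worse factor \<sigma> < 1, so the hypothesis applies
  again and \<open>E\<close> ends up in open sets of geometrically decreasing measure.\<close>

lemma negligible_if_shrinking:
  fixes E :: "real set"
  assumes bd: "bounded E" and \<rho>: "0 \<le> \<rho>" "\<rho> < 1"
    and shrink: "\<And>U. open U \<Longrightarrow> E \<subseteq> U \<Longrightarrow> emeasure lebesgue U < \<infinity> \<Longrightarrow>
      \<exists>V \<in> sets lebesgue. E \<subseteq> V \<and> emeasure lebesgue V \<le> ennreal \<rho> * emeasure lebesgue U"
  shows "negligible E"
proof -
  obtain A where A: "E \<subseteq> ball 0 A" using bd bounded_subset_ballD[of E 0] by blast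
  define M where "M = measure lebesgue (ball (0::real) A)"
  define \<sigma> where "\<sigma> = (\<rho> + 1) / 2"
  have \<sigma>: "\<rho> < \<sigma>" "0 < \<sigma>" "\<sigma> < 1" using \<rho> by (auto simp: \<sigma>_def)
  have step: "\<exists>U. open U \<and> E \<subseteq> U \<and> emeasure lebesgue U \<le> ennreal ((M + 1) * \<sigma> ^ n)" for n
  proof (induction n)
    case 0
    have "emeasure lebesgue (ball (0::real) A) \<le> ennreal (M + 1)"
      by (simp add: M_def emeasure_eq_measure2 ennreal_leI)
    then show ?case using A by (intro exI[of _ "ball 0 A"]) auto
  next
    case (Suc n)
    then obtain U where U: "open U" "E \<subseteq> U" "emeasure lebesgue U \<le> ennreal ((M + 1) * \<sigma> ^ n)" by blast
    have M: "M \<ge> 0" by (simp add: M_def)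
    obtain V where V: "V \<in> sets lebesgue" "E \<subseteq> V" "emeasure lebesgue V \<le> ennreal \<rho> * emeasure lebesgue U"
      using shrink[OF U(1,2)] U(3) by (metis ennreal_less_top infinity_ennreal_def order_le_less_trans)
    \<comment> \<open>The room between the factors \<rho> and \<sigma>. Using \<open>M + 1\<close>
      instead of \<open>M\<close> keeps it positive even if the enclosing ball is empty.\<close>
    define e where "e = (M + 1) * \<sigma> ^ n * (\<sigma> - \<rho>)"
    have "e > 0" using \<sigma> M by (auto simp: e_def)
    then obtain W where W: "open W" "V \<subseteq> W" "W - V \<in> lmeasurable" "emeasure lebesgue (W - V) < ennreal e"
      using sets_lebesgue_outer_open[OF V(1)] by metis
    have "emeasure lebesgue W = emeasure lebesgue (V \<union> (W - V))" using W by (simp add: Un_absorb1)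
    also have "\<dots> \<le> emeasure lebesgue V + emeasure lebesgue (W - V)"
      using V W by (intro emeasure_subadditive) auto
    also have "\<dots> \<le> ennreal \<rho> * ennreal ((M + 1) * \<sigma> ^ n) + ennreal e"
      using order_trans[OF V(3) mult_left_mono[OF U(3)]] W(4) by (intro add_mono) auto
    also have "\<dots> = ennreal (\<rho> * ((M + 1) * \<sigma> ^ n) + e)"
      using \<rho> M \<sigma> \<open>e > 0\<close> by (simp add: ennreal_mult[symmetric] flip: ennreal_plus)
    also have "\<dots> = ennreal ((M + 1) * \<sigma> ^ Suc n)"
      by (simp add: e_def algebra_simps)
    finally show ?case using W V by blast
  qed
  show ?thesis
  proof (rule negligible_outer_le[THEN iffD2], intro allI impI)
    fix e :: real assume "e > 0"
    have "(\<lambda>n. (M + 1) * \<sigma> ^ n) \<longlonglongrightarrow> (M + 1) * 0"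
      using \<sigma> by (intro tendsto_intros LIMSEQ_realpow_zero) auto
    then have "\<forall>\<^sub>F n in sequentially. (M + 1) * \<sigma> ^ n < e"
      using \<open>e > 0\<close> by (auto simp: order_tendsto_iff)
    then obtain n where n: "(M + 1) * \<sigma> ^ n < e" by (meson eventually_happens sequentially_bot)
    obtain U where U: "open U" "E \<subseteq> U" "emeasure lebesgue U \<le> ennreal ((M + 1) * \<sigma> ^ n)" using step by blast
    have "emeasure lebesgue U \<le> ennreal e" using U(3) n by (meson ennreal_leI less_imp_le order_trans)
    then have "U \<in> lmeasurable" "measure lebesgue U \<le> e"
      using U(1) \<open>e > 0\<close> by (auto simp: fmeasurable_def le_less_trans measure_def enn2real_leI)
    then show "\<exists>T. E \<subseteq> T \<and> T \<in> lmeasurable \<and> measure lebesgue T \<le> e" using U by blast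
  qed
qed

text \<open>
  Covering by short intervals, \<open>f\<close> maps neighbourhoods of \<open>E\<close> to sets covering \<open>f ` E\<close> that are smaller
  by the factor \<open>p\<close>; the inverse of \<open>f\<close> does the same with the factor \<open>1 / q\<close>. Since \<open>p / q < 1\<close>,
  iterating shrinks the outer measure of \<open>E\<close> to zero.
\<close>

lemma negligible_slope_gap:
  fixes f :: "real \<Rightarrow> real"
  assumes A: "A > 0" and lo: "\<And>x y. x < y \<Longrightarrow> A * (y - x) \<le> f y - f x"
    and hi: "\<And>x y. x < y \<Longrightarrow> f y - f x \<le> B * (y - x)"
    and pq: "0 < p" "p < q" and bd: "bounded E"
    and E_lo: "\<And>x d. x \<in> E \<Longrightarrow> d > 0 \<Longrightarrow> \<exists>y. y \<noteq> x \<and> \<bar>y - x\<bar> < d \<and> \<bar>f y - f x\<bar> \<le> p * \<bar>y - x\<bar>"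
    and E_hi: "\<And>x d. x \<in> E \<Longrightarrow> d > 0 \<Longrightarrow> \<exists>y. y \<noteq> x \<and> \<bar>y - x\<bar> < d \<and> q * \<bar>y - x\<bar> \<le> \<bar>f y - f x\<bar>"
  shows "negligible E"
proof -
  have fless: "f x < f y" if "x < y" for x y
    using lo[OF that] A that by (smt (verit) mult_pos_pos)
  then have smono: "strict_mono f" by (simp add: strict_mono_def)
  have lip: "\<bar>f y - f x\<bar> \<le> B * \<bar>y - x\<bar>" for x y
    using hi[of x y] hi[of y x] fless[of x y] fless[of y x] by (cases x y rule: linorder_cases) auto
  have lo': "A * \<bar>y - x\<bar> \<le> \<bar>f y - f x\<bar>" for x y
    using lo[of x y] lo[of y x] fless[of x y] fless[of y x] by (cases x y rule: linorder_cases) auto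
  have B: "B > 0" using lo[of 0 1] hi[of 0 1] A by auto
  have cont: "continuous_on UNIV f"
    by (rule lipschitz_on_continuous_on[of B]) (use lip B in \<open>auto simp: lipschitz_on_def dist_real_def abs_minus_commute\<close>)
  \<comment> \<open>Slopes of at least \<open>A\<close> make \<open>f\<close> onto, so its inverse
    is a total Lipschitz function, as the cover lemma demands.\<close>
  have surj: "\<exists>x. f x = z" for z
  proof -
    define t where "t = \<bar>z - f 0\<bar> / A"
    have "t \<ge> 0" "A * t = \<bar>z - f 0\<bar>" using A by (auto simp: t_def)
    then have "f (- t) \<le> z" "z \<le> f t"
      using lo[of "-t" 0] lo[of 0 t] by (cases "t = 0"; auto)+
    then show ?thesis using IVT'[of f "-t" z t] \<open>t \<ge> 0\<close> continuous_on_subset[OF cont] by auto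
  qed
  define h where "h = inv f"
  have fh: "f (h z) = z" for z using surj unfolding h_def by (metis f_inv_into_f rangeI)
  have hf: "h (f x) = x" for x using smono unfolding h_def by (simp add: strict_mono_imp_inj_on)
  have h_mono: "strict_mono h"
    by (rule strict_monoI) (metis fh fless linorder_neqE order.asym)
  have h_lip: "\<bar>h y - h x\<bar> \<le> (1 / A) * \<bar>y - x\<bar>" for x y
    using lo'[of "h y" "h x"] A by (simp add: fh field_simps abs_minus_commute)
  \<comment> \<open>The slack between \<open>p\<close> and \<open>s\<close> pays for replacing the
    cover of the image by an open one; \<open>s < q\<close> keeps the total factor
    \<open>s / q\<close> below 1.\<close>
  define s where "s = (p + q) / 2"
  have s: "p < s" "s < q" "0 < s" using pq by (auto simp: s_def)
  show ?thesis
  proof (rule negligible_if_shrinking[OF bd, of "s / q"])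
    show "0 \<le> s / q" "s / q < 1" using s by auto
    fix U assume U: "open U" "E \<subseteq> U" "emeasure lebesgue U < \<infinity>"
    obtain u where u: "u \<ge> 0" "emeasure lebesgue U = ennreal u"
      using U(3) by (cases "emeasure lebesgue U") auto
    show "\<exists>V\<in>sets lebesgue. E \<subseteq> V \<and> emeasure lebesgue V \<le> ennreal (s / q) * emeasure lebesgue U"
    proof (cases "u = 0")
      case True
      then show ?thesis using U u by (intro bexI[of _ U]) auto
    next
      case False
      obtain V where V: "V \<in> sets lebesgue" "f ` E \<subseteq> V" "emeasure lebesgue V \<le> ennreal p * emeasure lebesgue U"
        using increasing_image_cover[OF smono lip U(1,2) _ E_lo] pq by auto
      have "(s - p) * u > 0" using s u False by auto
      then obtain V' where V': "open V'" "V \<subseteq> V'" "V' - V \<in> lmeasurable" "emeasure lebesgue (V' - V) < ennreal ((s - p) * u)"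
        using sets_lebesgue_outer_open[OF V(1)] by metis
      have "emeasure lebesgue V' = emeasure lebesgue (V \<union> (V' - V))" using V' by (simp add: Un_absorb1)
      also have "\<dots> \<le> emeasure lebesgue V + emeasure lebesgue (V' - V)"
        using V V' by (intro emeasure_subadditive) auto
      also have "\<dots> \<le> ennreal p * ennreal u + ennreal ((s - p) * u)"
        using V(3) V'(4) u by (intro add_mono) auto
      also have "\<dots> = ennreal (p * u + (s - p) * u)"
        using pq u s by (simp add: ennreal_mult[symmetric] flip: ennreal_plus)
      finally have V'_le: "emeasure lebesgue V' \<le> ennreal (s * u)" by (simp add: algebra_simps)
      \<comment> \<open>The way back to \<open>E\<close>: slopes of \<open>f\<close> of at least
        \<open>q\<close> are slopes of \<open>h\<close> of at most \<open>1 / q\<close>, so the same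
        cover lemma applies to \<open>h\<close>.\<close>
      have "\<exists>W\<in>sets lebesgue. h ` (f ` E) \<subseteq> W \<and> emeasure lebesgue W \<le> ennreal (1 / q) * emeasure lebesgue V'"
      proof (rule increasing_image_cover[OF h_mono h_lip V'(1)])
        show "f ` E \<subseteq> V'" using V V' by auto
        show "0 \<le> 1 / q" using pq by auto
        fix z d :: real assume z: "z \<in> f ` E" and d: "d > 0"
        then obtain x where x: "x \<in> E" "z = f x" by auto
        obtain y where y: "y \<noteq> x" "\<bar>y - x\<bar> < d / B" "q * \<bar>y - x\<bar> \<le> \<bar>f y - f x\<bar>"
          using E_hi[OF x(1), of "d / B"] d B by auto
        have "\<bar>f y - f x\<bar> < d" using lip[of y x] y(2) B by (simp add: field_simps)
        moreover have "f y \<noteq> f x" using y(1) by (metis hf)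
        ultimately show "\<exists>y. y \<noteq> z \<and> \<bar>y - z\<bar> < d \<and> \<bar>h y - h z\<bar> \<le> 1 / q * \<bar>y - z\<bar>"
          using y pq x by (intro exI[of _ "f y"]) (auto simp: hf field_simps)
      qed
      then obtain W where W: "W \<in> sets lebesgue" "E \<subseteq> W" "emeasure lebesgue W \<le> ennreal (1 / q) * emeasure lebesgue V'"
        by (auto simp: image_image hf)
      have "emeasure lebesgue W \<le> ennreal (1 / q) * ennreal (s * u)"
        using order_trans[OF W(3) mult_left_mono[OF V'_le]] by simp
      also have "\<dots> = ennreal (s / q) * ennreal u"
        using pq s u by (simp add: ennreal_mult[symmetric])
      finally show ?thesis using W u by auto
    qed
  qed
qed

text \<open>Adding the line of slope \<open>L + 1\<close> gives difference quotients between 1 and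
  \<open>B = 2 * L + 1\<close> without changing differentiability. Where the derivative fails to
  exist, the lower and upper limits of the quotients differ, and two rationals between them place
  the point in one of countably many null sets.\<close>

theorem negligible_nondifferentiable_lipschitz:
  fixes g :: "real \<Rightarrow> real"
  assumes g: "L-lipschitz_on UNIV g"
  shows "negligible {x. \<not> g field_differentiable at x}"
proof -
  have L: "L \<ge> 0" and gl: "\<bar>g y - g x\<bar> \<le> L * \<bar>y - x\<bar>" for x y
    using g by (auto simp: lipschitz_on_def dist_real_def)
  define f where "f x = g x + (L + 1) * x" for x
  define B where "B = 2 * L + 1"
  have lo: "1 * (y - x) \<le> f y - f x" and hi: "f y - f x \<le> B * (y - x)" if "x < y" for x y
    using gl[of y x] that by (auto simp: f_def B_def algebra_simps abs_le_iff)
  define slope where "slope x y = (f y - f x) / (y - x)" for x y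
  have slope: "1 \<le> slope x y" "slope x y \<le> B" "\<bar>f y - f x\<bar> = slope x y * \<bar>y - x\<bar>" if "y \<noteq> x" for x y
  proof -
    have "1 \<le> slope x y \<and> slope x y \<le> B"
      using lo[of x y] hi[of x y] lo[of y x] hi[of y x] that
      by (cases x y rule: linorder_cases) (auto simp: slope_def field_simps)
    moreover have "f y - f x = slope x y * (y - x)" using that by (simp add: slope_def)
    ultimately show "1 \<le> slope x y" "slope x y \<le> B" "\<bar>f y - f x\<bar> = slope x y * \<bar>y - x\<bar>"
      by (auto simp: abs_mult)
  qed
  \<comment> \<open>The ball of radius \<open>n\<close> is there because the null set criterion asks
    for bounded sets.\<close>
  define E where "E p q n = {x \<in> ball 0 (real n).
      (\<forall>d>0. \<exists>y. y \<noteq> x \<and> \<bar>y - x\<bar> < d \<and> slope x y \<le> p) \<and> (\<forall>d>0. \<exists>y. y \<noteq> x \<and> \<bar>y - x\<bar> < d \<and> q \<le> slope x y)}" for p q n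
  have negE: "negligible (E p q n)" if "0 < p" "p < q" for p q n
  proof (rule negligible_slope_gap[of 1 f B p q])
    show "bounded (E p q n)" by (rule bounded_subset[OF bounded_ball[of 0 "real n"]]) (auto simp: E_def)
    fix x d :: real assume xd: "x \<in> E p q n" "d > 0"
    then obtain y1 y2 where y: "y1 \<noteq> x" "\<bar>y1 - x\<bar> < d" "slope x y1 \<le> p" "y2 \<noteq> x" "\<bar>y2 - x\<bar> < d" "q \<le> slope x y2"
      unfolding E_def by blast
    show "\<exists>y. y \<noteq> x \<and> \<bar>y - x\<bar> < d \<and> \<bar>f y - f x\<bar> \<le> p * \<bar>y - x\<bar>"
      using y slope(3)[of y1 x] by (intro exI[of _ y1]) (auto intro: mult_right_mono)
    show "\<exists>y. y \<noteq> x \<and> \<bar>y - x\<bar> < d \<and> q * \<bar>y - x\<bar> \<le> \<bar>f y - f x\<bar>"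
      using y slope(3)[of y2 x] by (intro exI[of _ y2]) (auto intro: mult_right_mono)
  qed (use lo hi that in auto)
  have cover: "\<exists>p q n. 0 < p \<and> p < q \<and> x \<in> E (of_rat p) (of_rat q) n" if x: "\<not> g field_differentiable at x" for x
  proof -
    let ?l = "Liminf (at x) (\<lambda>y. ereal (slope x y))" and ?u = "Limsup (at x) (\<lambda>y. ereal (slope x y))"
    have ev: "\<forall>\<^sub>F y in at x. y \<noteq> x" by (simp add: eventually_at_filter)
    have l1: "ereal 1 \<le> ?l" using ev slope(1) by (intro Liminf_bounded) (auto elim!: eventually_mono)
    have uB: "?u \<le> ereal B" using ev slope(2) by (intro Limsup_bounded) (auto elim!: eventually_mono)
    have lu: "?l \<le> ?u" by (rule Liminf_le_Limsup) simp
    have "?l \<noteq> ?u"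
    proof
      assume eq: "?l = ?u"
      have "?l \<le> ereal B" using lu uB by (rule order_trans)
      then obtain D where D: "?l = ereal D" using l1 by (cases ?l) auto
      have "((\<lambda>y. ereal (slope x y)) \<longlongrightarrow> ereal D) (at x)" using D eq by (intro Liminf_eq_Limsup) auto
      then have "(slope x \<longlongrightarrow> D) (at x)" by simp
      then have "(f has_field_derivative D) (at x)"
        by (simp add: has_field_derivative_iff slope_def[abs_def])
      then have "((\<lambda>y. f y - (L + 1) * y) has_field_derivative (D - (L + 1))) (at x)"
        by (auto intro!: derivative_eq_intros)
      moreover have "(\<lambda>y. f y - (L + 1) * y) = g" by (auto simp: f_def)
      ultimately show False using x by (auto simp: field_differentiable_def)
    qed
    then have "?l < ?u" using lu by auto
    then obtain p where p: "?l < ereal (of_rat p)" "ereal (of_rat p) < ?u" using ereal_dense3 by blast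
    then obtain q where q: "ereal (of_rat p) < ereal (of_rat q)" "ereal (of_rat q) < ?u" using ereal_dense3 by blast
    have p1: "1 < (of_rat p :: real)" using l1 p(1) by (metis ereal_less(3) less_ereal.simps(1) one_ereal_def order_le_less_trans)
    have np: "\<not> (\<forall>\<^sub>F y in at x. of_rat p \<le> slope x y)"
      using Liminf_bounded[of "ereal (of_rat p)" "\<lambda>y. ereal (slope x y)" "at x"] p(1) by auto
    have nq: "\<not> (\<forall>\<^sub>F y in at x. slope x y \<le> of_rat q)"
      using Limsup_bounded[of "\<lambda>y. ereal (slope x y)" "ereal (of_rat q)" "at x"] q(2) by auto
    obtain n where n: "\<bar>x\<bar> < real n" using reals_Archimedean2 by blast
    have "\<exists>y. y \<noteq> x \<and> \<bar>y - x\<bar> < d \<and> slope x y \<le> of_rat p" if "d > 0" for d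
      using np that unfolding eventually_at dist_real_def by (meson less_imp_le not_le)
    moreover have "\<exists>y. y \<noteq> x \<and> \<bar>y - x\<bar> < d \<and> of_rat q \<le> slope x y" if "d > 0" for d
      using nq that unfolding eventually_at dist_real_def by (meson less_imp_le not_le)
    ultimately have "x \<in> E (of_rat p) (of_rat q) n"
      using n by (auto simp: E_def)
    moreover have "(0::real) < of_rat p" using p1 by linarith
    then have "0 < p" by simp
    moreover have "p < q" using q(1) by (simp add: of_rat_less)
    ultimately show ?thesis by blast
  qed
  define I where "I = {(p, q, n). 0 < p \<and> p < q} \<inter> (UNIV :: (rat \<times> rat \<times> nat) set)"
  have "negligible (\<Union>((\<lambda>(p, q, n). E (of_rat p) (of_rat q) n) ` I))"
    using negE by (intro negligible_countable_Union countable_image countableI_type) (auto simp: I_def of_rat_less)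
  then show ?thesis
  proof (rule negligible_subset, safe)
    fix x assume "\<not> g field_differentiable at x"
    then obtain p q n where "0 < p" "p < q" and x: "x \<in> E (of_rat p) (of_rat q) n" using cover by blast
    then have "(p, q, n) \<in> I" by (simp add: I_def)
    then show "x \<in> \<Union>((\<lambda>(p, q, n). E (of_rat p) (of_rat q) n) ` I)" using x by (intro UN_I) auto
  qed
qed

text \<open>If \<open>g b < g a\<close>, some level \<open>y\<close> between them is not taken at
  any point of non-differentiability, since the image of that null set is null. At the last point of
  the interval with \<open>y \<le> g x\<close> the value is exactly \<open>y\<close>, the derivative
  exists and is positive, and so \<open>g\<close> exceeds \<open>y\<close> shortly afterwards, a
  contradiction.\<close>

lemma lipschitz_pos_deriv_mono:
  fixes g :: "real \<Rightarrow> real"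
  assumes g: "L-lipschitz_on UNIV g" and ab: "a \<le> b"
    and pos: "\<And>x D. a < x \<Longrightarrow> x < b \<Longrightarrow> (g has_real_derivative D) (at x) \<Longrightarrow> D > 0"
  shows "g a \<le> g b"
proof (rule ccontr)
  assume "\<not> g a \<le> g b"
  then have less: "g b < g a" by simp
  define N where "N = {x. \<not> g field_differentiable at x}"
  have gl: "\<bar>g y - g x\<bar> \<le> L * \<bar>y - x\<bar>" for x y
    using g by (auto simp: lipschitz_on_def dist_real_def)
  have "negligible (g ` N)"
  proof (rule negligible_locally_Lipschitz_image)
    show "negligible N" unfolding N_def by (rule negligible_nondifferentiable_lipschitz[OF g])
    show "\<exists>T B. open T \<and> x \<in> T \<and> (\<forall>y\<in>N \<inter> T. norm (g y - g x) \<le> B * norm (y - x))" for x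
      using gl by (intro exI[of _ UNIV] exI[of _ L]) auto
  qed auto
  then have "\<not> {g b<..<g a} \<subseteq> g ` N"
    using negligible_subset[of "g ` N" "{g b<..<g a}"] open_not_negligible[of "{g b<..<g a}"] less by auto
  then obtain y where "y \<in> {g b<..<g a}" and yN: "y \<notin> g ` N" by blast
  then have y: "g b < y" "y < g a" by auto
  have cont: "continuous_on UNIV g" using g by (rule lipschitz_on_continuous_on)
  define S where "S = {x \<in> {a..b}. y \<le> g x}"
  have "S = {a..b} \<inter> {x. y \<le> g x}" by (auto simp: S_def)
  moreover have "closed {x. y \<le> g x}" by (intro closed_Collect_le cont continuous_on_const)
  ultimately have "compact S" by (simp add: compact_Int_closed)
  moreover have "a \<in> S" using y ab by (auto simp: S_def)
  ultimately obtain x where x: "x \<in> S" "\<And>t. t \<in> S \<Longrightarrow> t \<le> x" using compact_attains_sup[of S] by auto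
  have after: "g t < y" if "x < t" "t \<le> b" for t 
  proof (rule ccontr)
    assume "\<not> g t < y"
    then have "t \<in> S" using x(1) that by (auto simp: S_def)
    then show False using x(2)[of t] that by simp
  qed
  have xS: "a \<le> x" "x \<le> b" "y \<le> g x" using x(1) by (auto simp: S_def)
  have "x \<noteq> b" "x \<noteq> a \<or> y \<noteq> g x" using xS y by auto
  then have xb: "x < b" using xS by simp
  have "(g \<longlongrightarrow> g x) (at_right x)"
    using cont by (simp add: continuous_on_eq_continuous_at isCont_def filterlim_at_split)
  moreover have "\<forall>\<^sub>F t in at_right x. g t \<le> y"
    using eventually_at_right_less[of x] eventually_at_right_real[OF xb]
    by eventually_elim (use after in \<open>simp add: less_imp_le\<close>)
  ultimately have "g x \<le> y" by (rule tendsto_upperbound) simp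
  then have gx: "g x = y" using xS by simp
  then have "x \<noteq> a" using y by auto
  then have ax: "a < x" using xS by simp
  obtain D where D: "(g has_real_derivative D) (at x)"
    using yN gx by (auto simp: N_def field_differentiable_def)
  have "D > 0" using pos[OF ax xb D] .
  then obtain d where "d > 0" "\<And>h. 0 < h \<Longrightarrow> h < d \<Longrightarrow> g x < g (x + h)"
    using DERIV_pos_inc_right[OF D] by blast
  then have "g x < g (x + min (d/2) (b - x))" using xb by (simp add: min_less_iff_disj)
  moreover have "g (x + min (d/2) (b - x)) < y" using \<open>d > 0\<close> xb by (intro after) auto
  ultimately show False using gx by simp
qed

section \<open>The nonlinearity\<close>

lemma vec_upd_nth [simp]: "vec_upd X i t $ j = (if j = i then t else X $ j)"
  by (simp add: vec_upd_def)

lemma vec_upd_same: "vec_upd X i (X $ i) = X"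
  by (simp add: vec_eq_iff)

lemma vec_upd_upd [simp]: "vec_upd (vec_upd X i s) i t = vec_upd X i t"
  by (simp add: vec_eq_iff)

lemma dist_vec_upd: "dist (vec_upd X i s) (vec_upd X i t) = \<bar>s - t\<bar>"
proof -
  have "vec_upd X i s - vec_upd X i t = (s - t) *\<^sub>R axis i 1"
    by (simp add: vec_eq_iff axis_def)
  then show ?thesis by (simp add: dist_norm)
qed

lemma vec_mono_by_coordinates:
  fixes G :: "real ^ 'n::finite \<Rightarrow> real"
  assumes step: "\<And>Z i s t. Z \<in> {0..1} \<Longrightarrow> 0 \<le> s \<Longrightarrow> s \<le> t \<Longrightarrow> t \<le> 1 \<Longrightarrow> G (vec_upd Z i s) \<le> G (vec_upd Z i t)"
    and XY: "X \<in> {0..1}" "Y \<in> {0..1}" "X \<le> Y"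
  shows "G X \<le> G Y"
proof -
  define M where "M S = (\<chi> i. if i \<in> S then Y $ i else X $ i)" for S
  have M01: "M S \<in> {0..1}" for S using XY by (auto simp: less_eq_vec_def M_def)
  have "G X \<le> G (M S)" if "finite S" for S
    using that
  proof (induction S)
    case empty
    then show ?case by (simp add: M_def)
  next
    case (insert i S)
    have "M S = vec_upd (M S) i (X $ i)" using insert(2) by (simp add: vec_eq_iff M_def)
    moreover have "M (insert i S) = vec_upd (M S) i (Y $ i)" by (simp add: vec_eq_iff M_def)
    moreover have "G (vec_upd (M S) i (X $ i)) \<le> G (vec_upd (M S) i (Y $ i))"
      using XY by (intro step M01) (auto simp: less_eq_vec_def)
    ultimately show ?case using insert.IH by simp
  qed
  from this[of UNIV] show ?thesis by (simp add: M_def)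
qed

text \<open>What the comparison arguments use of (A), with differentiability gone. \<open>H\<close>
  is the right-hand side of the second equation without its damping term: since
  \<open>r 0 = 0\<close>, the coupling \<open>\<alpha> * u1 z\<close> is a multiple of the
  coordinate \<open>X $ 0\<close>. \<open>L\<close> bounds the growth of \<open>2 * F\<close> along
  the diagonal.\<close>

locale wave_nonlinearity =
  fixes \<alpha> L :: real and F :: "real ^ 'n::{finite,zero} \<Rightarrow> real" and H :: "real ^ 'n::{finite,zero} \<Rightarrow> real"
  defines "H \<equiv> \<lambda>X. 2 * F X + \<alpha> * X $ 0"
  assumes \<alpha>_pos: "\<alpha> > 0" and L_nonneg: "L \<ge> 0"
    and F_cont: "continuous_on {0..1} F"
    and F_growth: "\<And>X d. X \<in> {0..1} \<Longrightarrow> X + vec d \<in> {0..1} \<Longrightarrow> 0 \<le> d \<Longrightarrow> 2 * F (X + vec d) \<le> 2 * F X + L * d"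
    and H_mono: "\<And>X Y. X \<in> {0..1} \<Longrightarrow> Y \<in> {0..1} \<Longrightarrow> X \<le> Y \<Longrightarrow> H X \<le> H Y"
    and H_strict: "\<And>X Y. X \<in> {0..1} \<Longrightarrow> Y \<in> {0..1} \<Longrightarrow> X \<le> Y \<Longrightarrow> X $ 0 < Y $ 0 \<Longrightarrow> H X < H Y"

text \<open>The section of \<open>H\<close> in \<open>X_0\<close> has derivative
  \<open>2 * D + \<alpha> > 0\<close> wherever one exists, so it is non-decreasing; if it took equal
  values at two points it would be constant between them, with derivative 0. The other coordinates
  are covered by the monotonicity in (A).\<close>

lemma wave_nonlinearityI:
  fixes F :: "real ^ 'n::{finite,zero} \<Rightarrow> real"
  assumes \<alpha>: "\<alpha> > 0" and A: "assumption_A \<alpha> F"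
  obtains L where "wave_nonlinearity \<alpha> L F"
proof -
  obtain L where L: "L-lipschitz_on {0..1} F" using A by (auto simp: assumption_A_def)
  have L0: "L \<ge> 0" using L by (rule lipschitz_on_nonneg)
  have mono: "F (vec_upd Z i s) \<le> F (vec_upd Z i t)" if "i \<noteq> 0" "Z \<in> {0..1}" "0 \<le> s" "s \<le> t" "t \<le> 1" for Z i s t
    using A that by (auto simp: assumption_A_def mono_on_def)
  have pos: "2 * D + \<alpha> > 0"
    if "Z \<in> {0..1}" "0 < x" "x < 1" "((\<lambda>t. F (vec_upd Z 0 t)) has_real_derivative D) (at x)" for Z x D
  proof -
    have "vec_upd Z 0 x \<in> {0..1}" using that by (auto simp: less_eq_vec_def)
    then show ?thesis using A that unfolding assumption_A_def by (auto dest!: bspec[of _ _ "vec_upd Z 0 x"])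
  qed
  define H where "H = (\<lambda>X. 2 * F X + \<alpha> * X $ 0)"
  have zero_le: "H (vec_upd Z 0 s) \<le> H (vec_upd Z 0 t) \<and> (s < t \<longrightarrow> H (vec_upd Z 0 s) < H (vec_upd Z 0 t))"
    if Z: "Z \<in> {0..1}" and st: "0 \<le> s" "s \<le> t" "t \<le> 1" for Z s t
  proof -
    \<comment> \<open>Clamping extends the section to a Lipschitz function on the whole line, as the
      monotonicity lemma requires. Derivatives are only examined in the open unit interval, where
      clamping is the identity.\<close>
    define cl where "cl x = max 0 (min 1 x)" for x :: real
    define k where "k x = 2 * F (vec_upd Z 0 (cl x)) + \<alpha> * x" for x
    have cl01: "vec_upd Z 0 (cl x) \<in> {0..1}" for x using Z by (auto simp: less_eq_vec_def cl_def)
    have cl_id: "cl x = x" if "0 \<le> x" "x \<le> 1" for x using that by (simp add: cl_def)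
    have F_le: "\<bar>F (vec_upd Z 0 (cl x)) - F (vec_upd Z 0 (cl y))\<bar> \<le> L * \<bar>x - y\<bar>" for x y
    proof -
      have "dist (F (vec_upd Z 0 (cl x))) (F (vec_upd Z 0 (cl y))) \<le> L * dist (vec_upd Z 0 (cl x)) (vec_upd Z 0 (cl y))"
        using L cl01 by (auto intro: lipschitz_onD)
      also have "\<dots> \<le> L * \<bar>x - y\<bar>"
        unfolding dist_vec_upd using L0 by (intro mult_left_mono) (auto simp: cl_def)
      finally show ?thesis by (simp add: dist_real_def)
    qed
    have "\<bar>k x - k y\<bar> \<le> 2 * (L * \<bar>x - y\<bar>) + \<alpha> * \<bar>x - y\<bar>" for x y
    proof -
      have "k x - k y = 2 * (F (vec_upd Z 0 (cl x)) - F (vec_upd Z 0 (cl y))) + \<alpha> * (x - y)"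
        by (simp add: k_def algebra_simps)
      also have "\<bar>\<dots>\<bar> \<le> 2 * \<bar>F (vec_upd Z 0 (cl x)) - F (vec_upd Z 0 (cl y))\<bar> + \<alpha> * \<bar>x - y\<bar>"
      proof -
        have "\<bar>\<alpha> * (x - y)\<bar> = \<alpha> * \<bar>x - y\<bar>" using \<alpha> by (simp add: abs_mult)
        moreover have "\<bar>2 * a + b\<bar> \<le> 2 * \<bar>a\<bar> + \<bar>b\<bar>" for a b :: real by linarith
        ultimately show ?thesis by metis
      qed
      also have "\<dots> \<le> 2 * (L * \<bar>x - y\<bar>) + \<alpha> * \<bar>x - y\<bar>" using F_le[of x y] by simp
      finally show ?thesis .
    qed
    then have k_lip: "(2 * L + \<alpha>)-lipschitz_on UNIV k"
      using L0 \<alpha> by (intro lipschitz_onI) (auto simp: dist_real_def algebra_simps)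
    have k_pos: "D > 0" if "0 < x" "x < 1" "(k has_real_derivative D) (at x)" for x D
    proof -
      have k': "((\<lambda>t. (k t - \<alpha> * t) / 2) has_real_derivative (D - \<alpha>) / 2) (at x)"
        using that(3) by (auto intro!: derivative_eq_intros)
      have eq: "\<forall>\<^sub>F t in nhds x. (k t - \<alpha> * t) / 2 = F (vec_upd Z 0 t)"
        using eventually_nhds_in_open[of "{0<..<1}" x] that
        by (auto simp: k_def cl_id elim!: eventually_mono)
      have "((\<lambda>t. F (vec_upd Z 0 t)) has_real_derivative (D - \<alpha>) / 2) (at x)"
        using k' DERIV_cong_ev[OF refl eq refl] by simp
      from pos[OF Z that(1,2) this] show ?thesis by (simp add: field_simps)
    qed
    have le: "k a \<le> k b" if "0 \<le> a" "a \<le> b" "b \<le> 1" for a b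
    proof (rule lipschitz_pos_deriv_mono[OF k_lip that(2)])
      fix x D assume "a < x" "x < b" "(k has_real_derivative D) (at x)"
      then show "D > 0" using k_pos[of x D] that by simp
    qed
    have "k s < k t" if "s < t"
    proof (rule ccontr)
      assume "\<not> k s < k t"
      then have eq: "k x = k s" if "s \<le> x" "x \<le> t" for x
        using le[of s x] le[of x t] st that by auto
      let ?m = "(s + t) / 2"
      have "\<forall>\<^sub>F x in nhds ?m. x \<in> {s<..<t}"
        using \<open>s < t\<close> by (intro eventually_nhds_in_open) auto
      then have "\<forall>\<^sub>F x in nhds ?m. k x = k s"
        by (rule eventually_mono) (rule eq, auto)
      then have "(k has_real_derivative 0) (at ?m)"
        using DERIV_cong_ev[of ?m ?m k "\<lambda>_. k s" 0 0] by simp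
      then show False using k_pos[of ?m 0] st \<open>s < t\<close> by auto
    qed
    moreover have "k x = H (vec_upd Z 0 x)" if "0 \<le> x" "x \<le> 1" for x
      using that by (simp add: k_def H_def cl_id)
    ultimately show ?thesis using le[of s t] st by auto
  qed
  have step: "H (vec_upd Z i s) \<le> H (vec_upd Z i t)"
    if "Z \<in> {0..1}" "0 \<le> s" "s \<le> t" "t \<le> 1" for Z i s t
    using zero_le[of Z s t] mono[of i Z s t] that by (cases "i = 0") (auto simp: H_def)
  have le: "H X \<le> H Y" if "X \<in> {0..1}" "Y \<in> {0..1}" "X \<le> Y" for X Y
    using step that by (rule vec_mono_by_coordinates)
  \<comment> \<open>Raising \<open>X $ 0\<close> first gives the strict inequality; raising the
    other coordinates afterwards cannot undo it.\<close>
  have less: "H X < H Y" if XY: "X \<in> {0..1}" "Y \<in> {0..1}" "X \<le> Y" "X $ 0 < Y $ 0" for X Y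
  proof -
    have "H X = H (vec_upd X 0 (X $ 0))" by (simp add: vec_upd_same)
    also have "\<dots> < H (vec_upd X 0 (Y $ 0))"
      using zero_le[OF XY(1), of "X $ 0" "Y $ 0"] XY by (auto simp: less_eq_vec_def)
    also have "\<dots> \<le> H Y"
      using XY by (intro le) (auto simp: less_eq_vec_def)
    finally show ?thesis .
  qed
  \<comment> \<open>The norm of the all-ones vector converts a diagonal shift into Euclidean
    distance, and the factor 2 comes from \<open>2 * F\<close>.\<close>
  let ?K = "2 * L * norm (1 :: real ^ 'n::{finite,zero})"
  have growth: "2 * F (X + vec d) \<le> 2 * F X + ?K * d" if X: "X \<in> {0..1}" "X + vec d \<in> {0..1}" and d: "0 \<le> d" for X d
  proof -
    have "dist (F (X + vec d)) (F X) \<le> L * dist (X + vec d) X"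
      using L X by (intro lipschitz_onD)
    also have "vec d = d *\<^sub>R (1 :: real ^ 'n::{finite,zero})" by (simp add: vec_eq_iff)
    then have "dist (X + vec d) X = d * norm (1 :: real ^ 'n::{finite,zero})" using d by (simp add: dist_norm)
    finally show ?thesis by (simp add: dist_real_def abs_le_iff algebra_simps)
  qed
  have "wave_nonlinearity \<alpha> ?K F"
    using \<alpha> L0 lipschitz_on_continuous_on[OF L] growth le less
    unfolding H_def by unfold_locales auto
  then show ?thesis by (rule that)
qed

context wave_nonlinearity begin

text \<open>Only growth along the diagonal is available, so \<open>U\<close> and \<open>V\<close>
  are separated by a diagonal pair: \<open>U \<le> A + vec d\<close> and \<open>A \<le> V\<close>.
  Cutting \<open>U $ i - d\<close> off at 0 keeps both points of the pair in the cube.\<close>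

lemma H_diff_le:
  assumes UV: "U \<in> {0..1}" "V \<in> {0..1}" and d: "0 \<le> d" "d \<le> 1" and le: "\<And>i. U $ i \<le> V $ i + d"
  shows "H U \<le> H V + (L + \<alpha>) * d"
proof -
  define A where "A = (\<chi> i. max (U $ i - d) 0)"
  have comp: "0 \<le> A $ i \<and> A $ i \<le> 1 \<and> A $ i + d \<le> 1 \<and> U $ i \<le> A $ i + d \<and> A $ i \<le> V $ i" for i
  proof -
    have "0 \<le> U $ i" "U $ i \<le> 1" "0 \<le> V $ i" using UV by (auto simp: less_eq_vec_def)
    then show ?thesis using d le[of i] by (auto simp: A_def max_def)
  qed
  then have A: "A \<in> {0..1}" "A + vec d \<in> {0..1}" "U \<le> A + vec d" "A \<le> V"
    using d by (auto simp: less_eq_vec_def)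
  have "H U \<le> H (A + vec d)" using H_mono A UV by auto
  also have "\<dots> \<le> H A + (L + \<alpha>) * d"
    using F_growth[OF A(1,2) d(1)] by (simp add: H_def algebra_simps)
  also have "H A \<le> H V" using H_mono A UV by auto
  finally show ?thesis by simp
qed

text \<open>The slab \<open>[l, l + \<beta>]\<close> stands for either of the two small cubes of assumption (C).\<close>

lemma H_diff_less:
  assumes C: "\<And>a X. a > 0 \<Longrightarrow> X \<in> {vec l..vec (l + \<beta>)} \<Longrightarrow> X + vec a \<in> {vec l..vec (l + \<beta>)} \<Longrightarrow> F (X + vec a) < F X"
    and l: "0 \<le> l" "l + \<beta> \<le> 1"
    and UV: "U \<in> {0..1}" "V \<in> {0..1}" and d: "0 < d" "d \<le> \<beta>" and le: "\<And>i. U $ i \<le> V $ i + d"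
    and U: "\<And>i. U $ i \<le> l + \<beta>" and V: "\<And>i. l \<le> V $ i"
  shows "H U < H V + \<alpha> * d"
proof -
  \<comment> \<open>The cut-off at \<open>l\<close> puts \<open>A\<close> and
    \<open>A + vec d\<close> into the slab, given \<open>d \<le> \<beta>\<close>. Of
    \<open>U\<close> only the upper bound of the slab is used and of \<open>V\<close> only the lower
    one, so controlling one wave in its tail will be enough.\<close>
  define A where "A = (\<chi> i. max (U $ i - d) l)"
  have comp: "l \<le> A $ i \<and> A $ i + d \<le> l + \<beta> \<and> U $ i \<le> A $ i + d \<and> A $ i \<le> V $ i" for i
    using d le[of i] U[of i] V[of i] by (auto simp: A_def max_def)
  have comp': "A $ i \<le> l + \<beta> \<and> 0 \<le> A $ i \<and> A $ i \<le> 1 \<and> A $ i + d \<le> 1 \<and> 0 \<le> A $ i + d" for i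
    using d l comp[of i] by linarith
  have le_d: "l \<le> A $ i + d" for i using comp[of i] d by linarith
  have A: "A \<in> {vec l..vec (l + \<beta>)}" "A + vec d \<in> {vec l..vec (l + \<beta>)}" "U \<le> A + vec d" "A \<le> V"
    "A \<in> {0..1}" "A + vec d \<in> {0..1}"
    using comp comp' le_d by (auto simp: less_eq_vec_def)
  have "H U \<le> H (A + vec d)" using H_mono A UV by auto
  also have "\<dots> < H A + \<alpha> * d"
    using C[OF d(1) A(1,2)] by (simp add: H_def algebra_simps)
  also have "H A \<le> H V" using H_mono A UV by auto
  finally show ?thesis by simp
qed

end

section \<open>Semicontinuous envelopes\<close>

lemma unit_rangeD:
  fixes u :: "real \<Rightarrow> real"
  assumes "range u \<subseteq> {0..1}"
  shows "0 \<le> u x" "u x \<le> 1"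
  using subsetD[OF assms rangeI[of u x]] by simp_all

lemma upper_env_bounds:
  assumes u: "range u \<subseteq> {0..1}"
  shows upper_env_ge: "u y \<le> upper_env u y"
    and upper_env_le: "(\<forall>\<^sub>F x in nhds y. u x \<le> b) \<Longrightarrow> upper_env u y \<le> b"
proof -
  let ?l = "Limsup (nhds y) (\<lambda>x. ereal (u x))"
  note u01 = unit_rangeD[OF u]
  have ge: "ereal (u y) \<le> ?l"
    unfolding Limsup_def by (intro INF_greatest SUP_upper) (auto dest: eventually_nhds_x_imp_x)
  have le: "?l \<le> ereal b" if "\<forall>\<^sub>F x in nhds y. u x \<le> b" for b
    using that by (intro Limsup_bounded) (auto elim!: eventually_mono)
  obtain t where t: "?l = ereal t"
    using ge le[of 1] u01 by (cases ?l) auto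
  show "u y \<le> upper_env u y" using ge t by (simp add: upper_env_def)
  show "(\<forall>\<^sub>F x in nhds y. u x \<le> b) \<Longrightarrow> upper_env u y \<le> b"
    using le[of b] t by (simp add: upper_env_def)
qed

lemma lower_env_bounds:
  assumes u: "range u \<subseteq> {0..1}"
  shows lower_env_le: "lower_env u y \<le> u y"
    and lower_env_ge: "(\<forall>\<^sub>F x in nhds y. b \<le> u x) \<Longrightarrow> b \<le> lower_env u y"
proof -
  let ?l = "Liminf (nhds y) (\<lambda>x. ereal (u x))"
  note u01 = unit_rangeD[OF u]
  have le: "?l \<le> ereal (u y)"
    unfolding Liminf_def by (intro SUP_least INF_lower) (auto dest: eventually_nhds_x_imp_x)
  have ge: "ereal b \<le> ?l" if "\<forall>\<^sub>F x in nhds y. b \<le> u x" for b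
    using that by (intro Liminf_bounded) (auto elim!: eventually_mono)
  obtain t where t: "?l = ereal t"
    using le ge[of 0] u01 by (cases ?l) auto
  show "lower_env u y \<le> u y" using le t by (simp add: lower_env_def)
  show "(\<forall>\<^sub>F x in nhds y. b \<le> u x) \<Longrightarrow> b \<le> lower_env u y"
    using ge[of b] t by (simp add: lower_env_def)
qed

lemma range_upper_env:
  assumes u: "range u \<subseteq> {0..1}"
  shows "range (upper_env u) \<subseteq> {0..1}"
proof safe
  fix y
  show "upper_env u y \<in> {0..1}"
    using upper_env_ge[OF u, of y] upper_env_le[OF u, of 1 y] unit_rangeD[OF u] by (auto intro: order_trans)
qed

lemma range_lower_env:
  assumes u: "range u \<subseteq> {0..1}"
  shows "range (lower_env u) \<subseteq> {0..1}"
proof safe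
  fix y
  show "lower_env u y \<in> {0..1}"
    using lower_env_le[OF u, of y] lower_env_ge[OF u, of 0 y] unit_rangeD[OF u] by (auto intro: order_trans)
qed

lemma upper_env_at_bot:
  assumes u: "range u \<subseteq> {0..1}" and lim: "(u \<longlongrightarrow> 0) at_bot"
  shows "(upper_env u \<longlongrightarrow> 0) at_bot"
proof (rule order_tendstoI)
  fix a :: real assume "a < 0"
  then show "\<forall>\<^sub>F x in at_bot. a < upper_env u x"
    using range_upper_env[OF u] by (intro always_eventually) (auto simp: image_subset_iff intro: less_le_trans)
next
  fix a :: real assume "0 < a"
  then have "\<forall>\<^sub>F x in at_bot. u x < a / 2" using order_tendstoD(2)[OF lim, of "a / 2"] by simp
  then obtain N where N: "\<And>x. x \<le> N \<Longrightarrow> u x < a / 2" by (auto simp: eventually_at_bot_linorder)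
  have "upper_env u x < a" if "x < N" for x
  proof -
    have "\<forall>\<^sub>F t in nhds x. u t \<le> a / 2"
    proof (rule eventually_mono)
      show "\<forall>\<^sub>F t in nhds x. t \<in> {..<N}" using that by (intro eventually_nhds_in_open) auto
    qed (use N in \<open>force intro: less_imp_le\<close>)
    then have "upper_env u x \<le> a / 2" by (rule upper_env_le[OF u])
    then show ?thesis using \<open>0 < a\<close> by simp
  qed
  then show "\<forall>\<^sub>F x in at_bot. upper_env u x < a"
    unfolding eventually_at_bot_dense by blast
qed

lemma lower_env_at_top:
  assumes u: "range u \<subseteq> {0..1}" and lim: "(u \<longlongrightarrow> 1) at_top"
  shows "(lower_env u \<longlongrightarrow> 1) at_top"
proof (rule order_tendstoI)
  fix a :: real assume "1 < a"
  then show "\<forall>\<^sub>F x in at_top. lower_env u x < a"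
    using range_lower_env[OF u] by (intro always_eventually) (auto simp: image_subset_iff intro: le_less_trans)
next
  fix a :: real assume "a < 1"
  then have "\<forall>\<^sub>F x in at_top. (a + 1) / 2 < u x" using order_tendstoD(1)[OF lim, of "(a + 1) / 2"] by simp
  then obtain N where N: "\<And>x. x \<ge> N \<Longrightarrow> (a + 1) / 2 < u x" by (auto simp: eventually_at_top_linorder)
  have "a < lower_env u x" if "x > N" for x
  proof -
    have "\<forall>\<^sub>F t in nhds x. (a + 1) / 2 \<le> u t"
    proof (rule eventually_mono)
      show "\<forall>\<^sub>F t in nhds x. t \<in> {N<..}" using that by (intro eventually_nhds_in_open) auto
    qed (use N in \<open>force intro: less_imp_le\<close>)
    then have "(a + 1) / 2 \<le> lower_env u x" by (rule lower_env_ge[OF u])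
    then show ?thesis using \<open>a < 1\<close> by (simp add: field_simps)
  qed
  then show "\<forall>\<^sub>F x in at_top. a < lower_env u x"
    unfolding eventually_at_top_dense by blast
qed

text \<open>Without a maximum, the sets where \<open>f\<close> lies below one of its values on the
  superlevel set form an open cover of that compact set; the point with the largest value in a
  finite subcover is then covered by none of them.\<close>

lemma usc_attains_max:
  fixes f :: "'a::heine_borel \<Rightarrow> real"
  assumes usc: "\<And>z b. f z < b \<Longrightarrow> \<forall>\<^sub>F w in nhds z. f w < b"
    and bd: "bounded {z. f z0 \<le> f z}"
  shows "\<exists>z. \<forall>w. f w \<le> f z"
proof (rule ccontr)
  assume "\<not> ?thesis"
  then have nomax: "\<exists>w. f z < f w" for z by (meson not_le)
  define S where "S = {z. f z0 \<le> f z}"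
  have op: "open {z. f z < b}" for b
    unfolding open_subopen[of "{z. f z < b}"] using usc by (force simp: eventually_nhds)
  have "S = - {z. f z < f z0}" by (auto simp: S_def)
  then have "closed S" using op by (simp add: closed_Compl)
  then have comp: "compact S" using bd by (simp add: S_def compact_eq_bounded_closed)
  have cov: "S \<subseteq> (\<Union>w\<in>S. {z. f z < f w})"
  proof
    fix z assume "z \<in> S"
    moreover obtain w where "f z < f w" using nomax by blast
    ultimately have "w \<in> S" by (simp add: S_def)
    then show "z \<in> (\<Union>w\<in>S. {z. f z < f w})" using \<open>f z < f w\<close> by blast
  qed
  obtain C where C: "C \<subseteq> S" "finite C" "S \<subseteq> (\<Union>w\<in>C. {z. f z < f w})"
    by (rule compactE_image[OF comp op cov])
  have "z0 \<in> S" by (simp add: S_def)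
  then have "C \<noteq> {}" using C by auto
  define m where "m = Max (f ` C)"
  obtain w where w: "w \<in> C" "f w = m"
    using Max_in[of "f ` C"] C \<open>C \<noteq> {}\<close> unfolding m_def by (metis (no_types, lifting) finite_imageI image_iff image_is_empty)
  then obtain w' where "w' \<in> C" "f w < f w'" using C by blast
  moreover have "f w' \<le> m" using C \<open>w' \<in> C\<close> by (simp add: m_def)
  ultimately show False using w by simp
qed

section \<open>Uniqueness of the velocity\<close>

locale wave_system = wave_nonlinearity \<alpha> L F for \<alpha> L :: real and F :: "real ^ 'n::{finite,zero} \<Rightarrow> real" +
  fixes r :: "'n::{finite,zero} \<Rightarrow> real"
  assumes r0: "r 0 = 0"
begin

definition window :: "(real \<Rightarrow> real) \<Rightarrow> real \<Rightarrow> real ^ 'n::{finite,zero}" where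
  "window u z = (\<chi> i. u (z + r i))"

lemma window_nth [simp]: "window u z $ i = u (z + r i)"
  by (simp add: window_def)

lemma window_in_cube: "range u \<subseteq> {0..1} \<Longrightarrow> window u z \<in> {0..1}"
  by (auto simp: less_eq_vec_def image_subset_iff)

lemma reaction_eq: "2 * F (\<chi> i. u1 (z + r i)) + \<alpha> * (u1 z - u2 z) = H (window u1 z) - \<alpha> * u2 z"
  by (simp add: H_def r0 algebra_simps flip: window_def)

text \<open>On a small cube (C) makes \<open>2 * F\<close> drop along the diagonal, so
  \<open>H\<close> gains strictly less than \<alpha> times the shift. Far to the left the
  \<open>u\<close> values lie below \<beta>; far to the right the \<open>v\<close> values exceed
  \<open>1 - \<beta>\<close>. Either fact also forces
  \<open>u2 x - v2 y \<le> \<beta>\<close>.\<close>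

lemma tail_comparison:
  assumes C: "assumption_C F"
    and u: "range u1 \<subseteq> {0..1}" "range u2 \<subseteq> {0..1}" "(u1 \<longlongrightarrow> 0) at_bot" "(u2 \<longlongrightarrow> 0) at_bot"
    and v: "range v1 \<subseteq> {0..1}" "range v2 \<subseteq> {0..1}" "(v1 \<longlongrightarrow> 1) at_top" "(v2 \<longlongrightarrow> 1) at_top"
  obtains R where "\<forall>x y. x \<le> - R \<or> R \<le> y \<longrightarrow> v2 y < u2 x \<longrightarrow>
      (\<forall>i. u1 (x + r i) \<le> v1 (y + r i) + (u2 x - v2 y)) \<longrightarrow>
      H (window u1 x) < H (window v1 y) + \<alpha> * (u2 x - v2 y)"
proof -
  obtain \<beta> where \<beta>: "\<beta> > 0" "\<beta> \<le> 1"
    and C0: "\<And>a X. a > 0 \<Longrightarrow> X \<in> {0..vec \<beta>} \<Longrightarrow> X + vec a \<in> {0..vec \<beta>} \<Longrightarrow> F (X + vec a) < F X"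
    and C1: "\<And>a X. a > 0 \<Longrightarrow> X \<in> {vec (1 - \<beta>)..1} \<Longrightarrow> X + vec a \<in> {vec (1 - \<beta>)..1} \<Longrightarrow> F (X + vec a) < F X"
    using C unfolding assumption_C_def by blast
  have vec0: "vec 0 = (0 :: real ^ 'n::{finite,zero})" and vec1: "vec 1 = (1 :: real ^ 'n::{finite,zero})" by (simp_all add: vec_eq_iff)
  have "\<forall>\<^sub>F x in at_bot. u1 x < \<beta> \<and> u2 x < \<beta>"
    using u \<beta> by (auto simp: order_tendsto_iff intro: eventually_conj)
  then obtain N1 where N1: "\<And>x. x \<le> N1 \<Longrightarrow> u1 x < \<beta> \<and> u2 x < \<beta>"
    by (auto simp: eventually_at_bot_linorder)
  have "\<forall>\<^sub>F x in at_top. 1 - \<beta> < v1 x \<and> 1 - \<beta> < v2 x"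
    using v \<beta> by (auto simp: order_tendsto_iff intro: eventually_conj)
  then obtain N2 where N2: "\<And>x. x \<ge> N2 \<Longrightarrow> 1 - \<beta> < v1 x \<and> 1 - \<beta> < v2 x"
    by (auto simp: eventually_at_top_linorder)
  define M where "M = Max (range (\<lambda>i. \<bar>r i\<bar>))"
  have M: "\<bar>r i\<bar> \<le> M" for i unfolding M_def by (intro Max_ge) auto
  have M0: "M \<ge> 0" using M[of 0] by simp
  \<comment> \<open>The largest shift \<open>M\<close> is added so that the whole window, not just
    its centre, lies in the tail.\<close>
  define R where "R = \<bar>N1\<bar> + \<bar>N2\<bar> + M"
  show ?thesis
  proof (rule that, intro allI impI)
    fix x y
    assume xy: "x \<le> - R \<or> R \<le> y" and less: "v2 y < u2 x"
      and le: "\<forall>i. u1 (x + r i) \<le> v1 (y + r i) + (u2 x - v2 y)"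
    have u01: "0 \<le> u1 z" "u1 z \<le> 1" "0 \<le> u2 z" "u2 z \<le> 1" for z using unit_rangeD u(1,2) by blast+
    have v01: "0 \<le> v1 z" "v1 z \<le> 1" "0 \<le> v2 z" "v2 z \<le> 1" for z using unit_rangeD v(1,2) by blast+
    show "H (window u1 x) < H (window v1 y) + \<alpha> * (u2 x - v2 y)"
      using xy
    proof
      assume x: "x \<le> - R"
      have "x + r i \<le> N1" for i using x M[of i] unfolding R_def by linarith
      then have U: "u1 (x + r i) \<le> 0 + \<beta>" for i using N1 by (simp add: less_imp_le)
      have "x \<le> N1" using x M0 unfolding R_def by linarith
      then have d: "u2 x - v2 y \<le> \<beta>" using N1[of x] v01(3)[of y] by simp
      show ?thesis
      proof (rule H_diff_less[where l = "0" and \<beta> = \<beta>])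
        show "F (X + vec a) < F X"
          if "a > 0" "X \<in> {vec (0)..vec (0 + \<beta>)}" "X + vec a \<in> {vec (0)..vec (0 + \<beta>)}" for a X
          using C0[OF that(1), of X] that(2,3) by (simp add: vec0)
        show "window u1 x \<in> {0..1}" "window v1 y \<in> {0..1}" by (intro window_in_cube u v)+
        show "window u1 x $ i \<le> window v1 y $ i + (u2 x - v2 y)" for i using le by simp
        show "window u1 x $ i \<le> 0 + \<beta>" for i using U[of i] by simp
        show "0 \<le> window v1 y $ i" for i using v01(1)[of "y + r i"] by simp
      qed (use \<beta> d less in auto)
    next
      assume y: "R \<le> y"
      have "y + r i \<ge> N2" for i using y M[of i] unfolding R_def by linarith
      then have V: "1 - \<beta> \<le> v1 (y + r i)" for i using N2 by (simp add: less_imp_le)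
      have "y \<ge> N2" using y M0 unfolding R_def by linarith
      then have d: "u2 x - v2 y \<le> \<beta>" using N2[of y] u01(4)[of x] by simp
      show ?thesis
      proof (rule H_diff_less[where l = "1 - \<beta>" and \<beta> = \<beta>])
        show "F (X + vec a) < F X"
          if "a > 0" "X \<in> {vec (1 - \<beta>)..vec (1 - \<beta> + \<beta>)}" "X + vec a \<in> {vec (1 - \<beta>)..vec (1 - \<beta> + \<beta>)}" for a X
          using C1[OF that(1), of X] that(2,3) by (simp add: vec1)
        show "window u1 x \<in> {0..1}" "window v1 y \<in> {0..1}" by (intro window_in_cube u v)+
        show "window u1 x $ i \<le> window v1 y $ i + (u2 x - v2 y)" for i using le by simp
        show "window u1 x $ i \<le> 1 - \<beta> + \<beta>" for i using u01(2)[of "x + r i"] by simp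
        show "1 - \<beta> \<le> window v1 y $ i" for i using V[of i] by simp
      qed (use \<beta> d less in auto)
    qed
  qed
qed

lemma subsolutionD:
  assumes sub: "visc_subsolution \<alpha> r F c UNIV u1 u2"
    and \<psi>: "\<And>x. (\<psi> has_real_derivative \<psi>' x) (at x)" "continuous_on UNIV \<psi>'"
  shows "local_max_at (\<lambda>x. u1 x - \<psi> x) z \<Longrightarrow> c * \<psi>' z \<le> \<alpha> * (u2 z - u1 z)"
    and "local_max_at (\<lambda>x. u2 x - \<psi> x) z \<Longrightarrow> c * \<psi>' z \<le> H (window u1 z) - \<alpha> * u2 z"
proof -
  have C1: "\<psi> C1_differentiable_on UNIV"
    using \<psi> by (auto simp: C1_differentiable_on_def has_real_derivative_iff_has_vector_derivative)
  have "(local_max_at (\<lambda>x. u1 x - \<psi> x) z \<longrightarrow> c * deriv \<psi> z \<le> \<alpha> * (u2 z - u1 z)) \<and>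
      (local_max_at (\<lambda>x. u2 x - \<psi> x) z \<longrightarrow> c * deriv \<psi> z \<le> H (window u1 z) - \<alpha> * u2 z)"
    using sub C1 unfolding visc_subsolution_def reaction_eq by blast
  moreover have "deriv \<psi> z = \<psi>' z" using \<psi>(1) by (rule DERIV_imp_deriv)
  ultimately show "local_max_at (\<lambda>x. u1 x - \<psi> x) z \<Longrightarrow> c * \<psi>' z \<le> \<alpha> * (u2 z - u1 z)"
    "local_max_at (\<lambda>x. u2 x - \<psi> x) z \<Longrightarrow> c * \<psi>' z \<le> H (window u1 z) - \<alpha> * u2 z"
    by simp_all
qed

lemma supersolutionD:
  assumes super: "visc_supersolution \<alpha> r F c UNIV u1 u2"
    and \<psi>: "\<And>x. (\<psi> has_real_derivative \<psi>' x) (at x)" "continuous_on UNIV \<psi>'"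
  shows "local_min_at (\<lambda>x. u1 x - \<psi> x) z \<Longrightarrow> \<alpha> * (u2 z - u1 z) \<le> c * \<psi>' z"
    and "local_min_at (\<lambda>x. u2 x - \<psi> x) z \<Longrightarrow> H (window u1 z) - \<alpha> * u2 z \<le> c * \<psi>' z"
proof -
  have C1: "\<psi> C1_differentiable_on UNIV"
    using \<psi> by (auto simp: C1_differentiable_on_def has_real_derivative_iff_has_vector_derivative)
  have "(local_min_at (\<lambda>x. u1 x - \<psi> x) z \<longrightarrow> \<alpha> * (u2 z - u1 z) \<le> c * deriv \<psi> z) \<and>
      (local_min_at (\<lambda>x. u2 x - \<psi> x) z \<longrightarrow> H (window u1 z) - \<alpha> * u2 z \<le> c * deriv \<psi> z)"
    using super C1 unfolding visc_supersolution_def reaction_eq by blast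
  moreover have "deriv \<psi> z = \<psi>' z" using \<psi>(1) by (rule DERIV_imp_deriv)
  ultimately show "local_min_at (\<lambda>x. u1 x - \<psi> x) z \<Longrightarrow> \<alpha> * (u2 z - u1 z) \<le> c * \<psi>' z"
    "local_min_at (\<lambda>x. u2 x - \<psi> x) z \<Longrightarrow> H (window u1 z) - \<alpha> * u2 z \<le> c * \<psi>' z"
    by simp_all
qed

end

lemma usc_diff_less_prod:
  assumes u: "usc u" and v: "lsc v" and g: "continuous_on UNIV (g :: real \<times> real \<Rightarrow> real)"
    and less: "u (fst z) - v (snd z) < g z"
  shows "\<forall>\<^sub>F w in nhds z. u (fst w) - v (snd w) < g w"
proof -
  define \<delta> where "\<delta> = (g z - (u (fst z) - v (snd z))) / 3"
  have \<delta>: "\<delta> > 0" using less by (simp add: \<delta>_def)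
  have f1: "filterlim fst (nhds (fst z)) (nhds z)" and f2: "filterlim snd (nhds (snd z)) (nhds z)"
    by (intro tendsto_fst tendsto_snd filterlim_ident)+
  have "\<forall>\<^sub>F x in nhds (fst z). u x < u (fst z) + \<delta>" using u \<delta> by (simp add: usc_def)
  then have "\<forall>\<^sub>F w in nhds z. u (fst w) < u (fst z) + \<delta>" using f1 by (rule eventually_compose_filterlim)
  moreover have "\<forall>\<^sub>F y in nhds (snd z). v (snd z) - \<delta> < v y" using v \<delta> by (simp add: lsc_def)
  then have "\<forall>\<^sub>F w in nhds z. v (snd z) - \<delta> < v (snd w)" using f2 by (rule eventually_compose_filterlim)
  moreover have "(g \<longlongrightarrow> g z) (nhds z)"
    using continuous_on_interior[OF g, of z] by (simp add: isCont_def tendsto_at_iff_tendsto_nhds)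
  then have "\<forall>\<^sub>F w in nhds z. g z - \<delta> < g w" using \<delta> by (auto intro: order_tendstoD)
  ultimately show ?thesis
  proof eventually_elim
    case (elim w)
    have "u (fst z) - v (snd z) + 3 * \<delta> = g z" by (simp add: \<delta>_def field_simps)
    then show ?case using elim by linarith
  qed
qed

context wave_system begin

text \<open>
  Let \<open>T\<close> be the maximum of \<open>(u\<^sub>i x - v\<^sub>i y) / \<theta> (y - x)\<close> with \<open>\<theta> s = 1 + exp (K (s0 - s))\<close>. At a
  maximum point, \<open>u\<^sub>i\<close> and \<open>v\<^sub>i\<close> are tested with the same slope \<open>p = - T \<theta>' (y - x) > 0\<close>, and every
  difference \<open>u\<^sub>j (x + h) - v\<^sub>j (y + h)\<close> is at most \<open>T \<theta> (y - x)\<close> because \<open>\<theta>\<close> depends on the shift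
  \<open>y - x\<close> only. For large shifts assumption (C) bounds \<open>(c - c') p\<close> by zero, for the others the
  growth rate \<open>K\<close> beats the Lipschitz constant.
\<close>

lemma sub_below_super_if_faster:
  assumes C: "assumption_C F" and cc: "c' < c"
    and sub: "visc_subsolution \<alpha> r F c UNIV u1 u2" and super: "visc_supersolution \<alpha> r F c' UNIV v1 v2"
    and u: "range u1 \<subseteq> {0..1}" "range u2 \<subseteq> {0..1}" "(u1 \<longlongrightarrow> 0) at_bot" "(u2 \<longlongrightarrow> 0) at_bot"
    and v: "range v1 \<subseteq> {0..1}" "range v2 \<subseteq> {0..1}" "(v1 \<longlongrightarrow> 1) at_top" "(v2 \<longlongrightarrow> 1) at_top"
  shows "u1 a \<le> v1 b"
proof (rule ccontr)
  assume "\<not> u1 a \<le> v1 b"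
  then have pos0: "u1 a - v1 b > 0" by simp
  obtain R where R: "\<forall>x y. x \<le> - R \<or> R \<le> y \<longrightarrow> v2 y < u2 x \<longrightarrow>
      (\<forall>i. u1 (x + r i) \<le> v1 (y + r i) + (u2 x - v2 y)) \<longrightarrow>
      H (window u1 x) < H (window v1 y) + \<alpha> * (u2 x - v2 y)"
    by (rule tail_comparison[OF C u v])
  have u01: "0 \<le> u1 z" "u1 z \<le> 1" "0 \<le> u2 z" "u2 z \<le> 1" for z using unit_rangeD u(1,2) by blast+
  have v01: "0 \<le> v1 z" "v1 z \<le> 1" "0 \<le> v2 z" "v2 z \<le> 1" for z using unit_rangeD v(1,2) by blast+
  \<comment> \<open>Chosen so that \<open>(c - c') * K = 2 * L + 1\<close>, just above the
    \<open>2 * L\<close> that the estimate for small shifts needs.\<close>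
  define K where "K = (2 * L + 1) / (c - c')"
  have K: "K > 0" "(c - c') * K = 2 * L + 1" using cc L_nonneg by (auto simp: K_def)
  \<comment> \<open>A shift \<open>y - x \<ge> 2 * R\<close> forces \<open>x \<le> - R\<close> or
    \<open>R \<le> y\<close>.\<close>
  define s0 where "s0 = 2 * R"
  define \<theta> where "\<theta> s = 1 + exp (K * (s0 - s))" for s
  have \<theta>_ge: "\<theta> s > 1" for s by (simp add: \<theta>_def)
  define m where "m w = max (u1 (fst w) - v1 (snd w)) (u2 (fst w) - v2 (snd w))" for w
  define f where "f w = m w / \<theta> (snd w - fst w)" for w
  have f_less: "f w < t \<longleftrightarrow> m w < t * \<theta> (snd w - fst w)" for w t
    using \<theta>_ge[of "snd w - fst w"] by (simp add: f_def divide_less_eq)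
  have f_ab: "f (a, b) > 0"
    using pos0 \<theta>_ge[of "b - a"] by (auto simp: f_def m_def intro!: divide_pos_pos)
  have "\<exists>w. \<forall>w'. f w' \<le> f w"
  proof (rule usc_attains_max[where ?z0.0 = "(a, b)"])
    fix w t assume "f w < t"
    then have *: "u1 (fst w) - v1 (snd w) < t * \<theta> (snd w - fst w)" "u2 (fst w) - v2 (snd w) < t * \<theta> (snd w - fst w)"
      by (auto simp: f_less m_def)
    have cont: "continuous_on UNIV (\<lambda>w::real \<times> real. t * \<theta> (snd w - fst w))"
      unfolding \<theta>_def by (intro continuous_intros)
    have "usc u1" "usc u2" "lsc v1" "lsc v2"
      using sub super by (auto simp: visc_subsolution_def visc_supersolution_def)
    then have "\<forall>\<^sub>F w in nhds w. u1 (fst w) - v1 (snd w) < t * \<theta> (snd w - fst w)"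
      "\<forall>\<^sub>F w in nhds w. u2 (fst w) - v2 (snd w) < t * \<theta> (snd w - fst w)"
      using usc_diff_less_prod[OF _ _ cont] * by blast+
    then show "\<forall>\<^sub>F w in nhds w. f w < t"
      by eventually_elim (auto simp: f_less m_def)
  next
    \<comment> \<open>Where \<open>f\<close> is at least \<open>e\<close>, the bound \<theta> > 1
      gives \<open>m > e\<close>, which keeps \<open>x\<close> away from minus infinity and
      \<open>y\<close> away from plus infinity. The remaining escape, \<open>x - y\<close> growing,
      is stopped by \<open>m \<le> 1\<close> and the growth of \<theta> for negative shifts.\<close>
    define e where "e = f (a, b)"
    have e: "e > 0" using f_ab by (simp add: e_def)
    obtain M1 where M1: "\<And>x. x \<le> M1 \<Longrightarrow> u1 x < e \<and> u2 x < e"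
      using eventually_conj[OF order_tendstoD(2)[OF u(3) e] order_tendstoD(2)[OF u(4) e]]
      by (auto simp: eventually_at_bot_linorder)
    obtain M2 where M2: "\<And>x. x \<ge> M2 \<Longrightarrow> 1 - e < v1 x \<and> 1 - e < v2 x"
      using eventually_conj[OF order_tendstoD(1)[OF v(3), of "1 - e"] order_tendstoD(1)[OF v(4), of "1 - e"]] e
      by (auto simp: eventually_at_top_linorder)
    define S where "S = 1 / (e * K) - s0"
    have "x \<in> {M1..M2 + S} \<and> y \<in> {M1 - S..M2}" if "f (a, b) \<le> f (x, y)" for x y
    proof -
      have "e * \<theta> (y - x) \<le> m (x, y)"
        using that f_less[of "(x, y)" e] by (simp add: e_def not_less[symmetric])
      moreover have "e * 1 < e * \<theta> (y - x)" using \<theta>_ge e by (intro mult_strict_left_mono) auto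
      moreover have "m (x, y) \<le> 1" using u01[of x] v01[of y] by (auto simp: m_def)
      ultimately have m: "e < m (x, y)" and \<theta>_le: "e * \<theta> (y - x) \<le> 1" by auto
      have x: "M1 \<le> x"
      proof (rule ccontr)
        assume "\<not> M1 \<le> x"
        then show False using M1[of x] m v01[of y] by (auto simp: m_def less_max_iff_disj)
      qed
      have y: "y \<le> M2"
      proof (rule ccontr)
        assume "\<not> y \<le> M2"
        then show False using M2[of y] m u01[of x] by (auto simp: m_def less_max_iff_disj)
      qed
      have "K * (s0 - (y - x)) \<le> \<theta> (y - x)"
        using exp_ge_add_one_self[of "K * (s0 - (y - x))"] unfolding \<theta>_def by linarith
      then have "e * (K * (s0 - (y - x))) \<le> 1"
        using e \<theta>_le by (meson mult_left_mono less_imp_le order_trans)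
      then have "s0 - (y - x) \<le> 1 / (e * K)" using e K by (simp add: field_simps)
      then have "x - y \<le> S" unfolding S_def by linarith
      then show ?thesis using x y by auto
    qed
    then have "{z. f (a, b) \<le> f z} \<subseteq> {M1..M2 + S} \<times> {M1 - S..M2}" by auto
    then show "bounded {z. f (a, b) \<le> f z}"
      by (rule bounded_subset[rotated]) (intro bounded_Times bounded_closed_interval)
  qed
  then obtain x y where max: "\<And>w. f w \<le> f (x, y)" by auto
  define T where "T = f (x, y)"
  have T: "T > 0" using f_ab max[of "(a, b)"] unfolding T_def by linarith
  have m_le: "m w \<le> T * \<theta> (snd w - fst w)" for w
  proof -
    have "f w \<le> T" using max by (simp add: T_def)
    moreover have "0 < \<theta> (snd w - fst w)" using \<theta>_ge by (rule order_less_trans[OF zero_less_one])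
    ultimately show ?thesis by (simp add: f_def pos_divide_le_eq)
  qed
  have u1_le: "u1 x' - v1 y' \<le> T * \<theta> (y' - x')" and u2_le: "u2 x' - v2 y' \<le> T * \<theta> (y' - x')" for x' y'
    using m_le[of "(x', y')"] by (auto simp: m_def)
  have m_eq: "m (x, y) = T * \<theta> (y - x)"
    using \<theta>_ge[of "y - x"] by (simp add: T_def f_def)
  define E where "E = exp (K * (s0 - (y - x)))"
  define p where "p = T * K * E"
  have p: "p > 0" using T K by (simp add: p_def E_def)
  define \<psi>u where "\<psi>u x' = T * \<theta> (y - x')" for x'
  define \<psi>v where "\<psi>v y' = - (T * \<theta> (y' - x))" for y'
  have \<psi>u': "(\<psi>u has_real_derivative T * (K * exp (K * (s0 - (y - x'))))) (at x')" for x'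
    unfolding \<psi>u_def \<theta>_def by (auto intro!: derivative_eq_intros)
  have \<psi>v': "(\<psi>v has_real_derivative T * (K * exp (K * (s0 - (y' - x))))) (at y')" for y'
    unfolding \<psi>v_def \<theta>_def by (auto intro!: derivative_eq_intros)
  have cont: "continuous_on UNIV (\<lambda>x'. T * (K * exp (K * (s0 - (y - x')))))"
    "continuous_on UNIV (\<lambda>y'. T * (K * exp (K * (s0 - (y' - x)))))"
    by (intro continuous_intros)+
  note subD = subsolutionD[OF sub \<psi>u' cont(1), of x] and superD = supersolutionD[OF super \<psi>v' cont(2), of y]
  consider "u1 x - v1 y = T * \<theta> (y - x)" | "u2 x - v2 y = T * \<theta> (y - x)"
    using m_eq by (auto simp: m_def max_def split: if_splits)
  then show False
  proof cases
    \<comment> \<open>If the first component attains the maximum, the difference of the second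
      components is no larger, so subtracting the two linear couplings already gives a non-positive
      bound for \<open>(c - c') * p\<close>.\<close>
    case 1
    have "local_max_at (\<lambda>x'. u1 x' - \<psi>u x') x"
      unfolding local_max_at_def \<psi>u_def
    proof (rule always_eventually, rule allI)
      fix x' show "u1 x' - T * \<theta> (y - x') \<le> u1 x - T * \<theta> (y - x)"
        using u1_le[of x' y] 1 by linarith
    qed
    then have "c * p \<le> \<alpha> * (u2 x - u1 x)"
      using subD(1) by (auto simp: p_def E_def mult.assoc)
    moreover have "local_min_at (\<lambda>y'. v1 y' - \<psi>v y') y"
      unfolding local_min_at_def \<psi>v_def
    proof (rule always_eventually, rule allI)
      fix y' show "v1 y - - (T * \<theta> (y - x)) \<le> v1 y' - - (T * \<theta> (y' - x))"
        using u1_le[of x y'] 1 by linarith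
    qed
    then have "\<alpha> * (v2 y - v1 y) \<le> c' * p"
      using superD(1) by (auto simp: p_def E_def mult.assoc)
    moreover have "\<alpha> * (u2 x - u1 x) \<le> \<alpha> * (v2 y - v1 y)"
      using u2_le[of x y] 1 \<alpha>_pos by (intro mult_left_mono) linarith+
    ultimately have "c * p \<le> c' * p" by linarith
    then show False using p cc by simp
  next
    case 2
    have "local_max_at (\<lambda>x'. u2 x' - \<psi>u x') x"
      unfolding local_max_at_def \<psi>u_def
    proof (rule always_eventually, rule allI)
      fix x' show "u2 x' - T * \<theta> (y - x') \<le> u2 x - T * \<theta> (y - x)"
        using u2_le[of x' y] 2 by linarith
    qed
    then have su: "c * p \<le> H (window u1 x) - \<alpha> * u2 x"
      using subD(2) by (auto simp: p_def E_def mult.assoc)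
    have "local_min_at (\<lambda>y'. v2 y' - \<psi>v y') y"
      unfolding local_min_at_def \<psi>v_def
    proof (rule always_eventually, rule allI)
      fix y' show "v2 y - - (T * \<theta> (y - x)) \<le> v2 y' - - (T * \<theta> (y' - x))"
        using u2_le[of x y'] 2 by linarith
    qed
    then have sv: "H (window v1 y) - \<alpha> * v2 y \<le> c' * p"
      using superD(2) by (auto simp: p_def E_def mult.assoc)
    define d where "d = u2 x - v2 y"
    have d_eq: "d = T * (1 + E)" using 2 by (simp add: d_def \<theta>_def E_def)
    have "E > 0" by (simp add: E_def)
    then have d: "0 < d" "d \<le> 1" using T d_eq u01[of x] v01[of y] by (auto simp: d_def)
    have le: "u1 (x + h) \<le> v1 (y + h) + d" for h
      using u1_le[of "x + h" "y + h"] 2 by (simp add: d_def)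
    have main: "(c - c') * p \<le> H (window u1 x) - H (window v1 y) - \<alpha> * d"
      using su sv by (simp add: d_def algebra_simps)
    show False
    proof (cases "y - x \<ge> s0")
      case True
      then have "x \<le> - R \<or> R \<le> y" unfolding s0_def by linarith
      then have "H (window u1 x) < H (window v1 y) + \<alpha> * d"
        using R[rule_format, of x y] d(1) le by (simp add: d_def)
      then have "(c - c') * p < 0" using main by linarith
      then show False using p cc by (simp add: mult_less_0_iff)
    next
      case False
      \<comment> \<open>Hence \<open>d = T * (1 + E) \<le> 2 * T * E\<close>, and
        \<open>(c - c') * p = (2 * L + 1) * T * E\<close> exceeds \<open>L * d\<close>.\<close>
      then have E: "E \<ge> 1" using K by (simp add: E_def)
      have "H (window u1 x) \<le> H (window v1 y) + (L + \<alpha>) * d"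
        using H_diff_le[OF window_in_cube[OF u(1)] window_in_cube[OF v(1)], of d x y] d le by simp
      then have "(c - c') * p \<le> L * d" using main by (simp add: algebra_simps)
      moreover have "(c - c') * p = (2 * L + 1) * (T * E)"
        unfolding p_def K(2)[symmetric] by (simp add: ac_simps)
      moreover have "L * d \<le> L * (T * (2 * E))"
        unfolding d_eq using L_nonneg T E by (intro mult_left_mono) auto
      moreover have "T * E > 0" using T E by simp
      ultimately show False by (simp add: algebra_simps)
    qed
  qed
qed

text \<open>With \<open>c' < c\<close>, all values of the first wave would lie below all values of
  the second, although the first tends to 1 at one end and the second to 0 at the other.\<close>

lemma travelling_wave_speed_le:
  assumes C: "assumption_C F"
    and \<phi>: "travelling_wave \<alpha> r F c \<phi>1 \<phi>2" and \<phi>': "travelling_wave \<alpha> r F c' \<phi>1' \<phi>2'"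
  shows "c \<le> c'"
proof (rule ccontr)
  assume "\<not> c \<le> c'"
  then have cc: "c' < c" by simp
  have r: "range \<phi>1 \<subseteq> {0..1}" "range \<phi>2 \<subseteq> {0..1}" "range \<phi>1' \<subseteq> {0..1}" "range \<phi>2' \<subseteq> {0..1}"
    and sub: "visc_subsolution \<alpha> r F c UNIV (upper_env \<phi>1) (upper_env \<phi>2)"
    and super: "visc_supersolution \<alpha> r F c' UNIV (lower_env \<phi>1') (lower_env \<phi>2')"
    and lim: "(\<phi>1 \<longlongrightarrow> 0) at_bot" "(\<phi>2 \<longlongrightarrow> 0) at_bot" "(\<phi>1' \<longlongrightarrow> 1) at_top" "(\<phi>2' \<longlongrightarrow> 1) at_top"
    and lim': "(\<phi>1 \<longlongrightarrow> 1) at_top" "(\<phi>1' \<longlongrightarrow> 0) at_bot"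
    using \<phi> \<phi>' by (auto simp: travelling_wave_def visc_solution_def)
  have le: "upper_env \<phi>1 a \<le> lower_env \<phi>1' b" for a b
    by (intro sub_below_super_if_faster[OF C cc sub super] range_upper_env range_lower_env
        upper_env_at_bot lower_env_at_top r lim)
  obtain a where a: "1 / 2 < \<phi>1 a"
    using order_tendstoD(1)[OF lim'(1), of "1/2"] by (auto simp: eventually_at_top_linorder)
  obtain b where b: "\<phi>1' b < 1 / 2"
    using order_tendstoD(2)[OF lim'(2), of "1/2"] by (auto simp: eventually_at_bot_linorder)
  show False
    using le[of a b] a b upper_env_ge[OF r(1), of a] lower_env_le[OF r(3), of b] by linarith
qed

end

section \<open>Continuous viscosity solutions are classical\<close>

lemma local_max_at_reflect:
  assumes "local_max_at f z"
  shows "local_max_at (\<lambda>x. f (- x)) (- z)"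
proof -
  have "filterlim uminus (nhds z) (nhds (- z))"
    using tendsto_minus[OF filterlim_ident[of "nhds (- z)"]] by simp
  with assms show ?thesis
    unfolding local_max_at_def by (auto dest: eventually_compose_filterlim)
qed

lemma continuous_derivative_reflect:
  assumes "\<And>x. (\<psi> has_real_derivative \<psi>' x) (at x)" "continuous_on UNIV \<psi>'"
  shows "((\<lambda>x. \<psi> (- x)) has_real_derivative - \<psi>' (- x)) (at x)" "continuous_on UNIV (\<lambda>x. - \<psi>' (- x :: real) :: real)"
proof -
  have "((\<lambda>x. \<psi> (- x)) has_real_derivative \<psi>' (- x) * - 1) (at x)"
    by (rule DERIV_chain2[OF assms(1)]) (auto intro!: derivative_eq_intros)
  then show "((\<lambda>x. \<psi> (- x)) has_real_derivative - \<psi>' (- x)) (at x)" by simp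
  show "continuous_on UNIV (\<lambda>x. - \<psi>' (- x))"
    by (intro continuous_intros continuous_on_compose2[OF assms(2)]) auto
qed

text \<open>A rise of \<open>w\<close> is tested with an increasing exponential, small up to
  \<open>b\<close> and large at \<open>b + 1\<close>. The difference then has an interior maximum,
  where the test function has positive slope.\<close>

lemma viscosity_nonincreasing:
  fixes w :: "real \<Rightarrow> real"
  assumes w: "continuous_on UNIV w"
    and test: "\<And>\<psi> \<psi>' z. (\<And>x. (\<psi> has_real_derivative \<psi>' x) (at x)) \<Longrightarrow> continuous_on UNIV \<psi>' \<Longrightarrow>
      local_max_at (\<lambda>x. w x - \<psi> x) z \<Longrightarrow> \<psi>' z \<le> 0"
    and ab: "a \<le> b"
  shows "w b \<le> w a"
proof (rule ccontr)
  assume "\<not> w b \<le> w a"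
  then have less: "w a < w b" by simp
  \<comment> \<open>Half the rise: \<open>w b - q b = w a + A\<close> beats the value at
    \<open>a\<close>. The constant \<open>K\<close> below makes \<open>q (b + 1)\<close> large
    enough to exclude the other end point.\<close>
  define A where "A = (w b - w a) / 2"
  have A: "A > 0" "w a + 2 * A = w b" using less by (auto simp: A_def field_simps)
  define K where "K = (\<bar>w (b + 1) - w b\<bar> + 1) / A"
  have K: "K > 0" "A * K = \<bar>w (b + 1) - w b\<bar> + 1" using A by (auto simp: K_def)
  define q where "q x = A * exp (K * (x - b))" for x
  have q': "(q has_real_derivative A * (K * exp (K * (x - b)))) (at x)" for x
    unfolding q_def by (auto intro!: derivative_eq_intros)
  have "continuous_on {a..b + 1} (\<lambda>x. w x - q x)"
    unfolding q_def by (intro continuous_intros continuous_on_subset[OF w]) auto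
  then obtain z where z: "z \<in> {a..b + 1}" "\<And>x. x \<in> {a..b + 1} \<Longrightarrow> w x - q x \<le> w z - q z"
    using continuous_attains_sup[of "{a..b + 1}" "\<lambda>x. w x - q x"] ab by auto
  have "q a > 0" "q b = A" using A by (auto simp: q_def)
  moreover have zb: "w b - q b \<le> w z - q z" using z(2)[of b] ab by simp
  ultimately have "z \<noteq> a" using A by auto
  have "A * (1 + K) \<le> q (b + 1)"
    using A exp_ge_add_one_self[of K] by (simp add: q_def)
  then have "A + \<bar>w (b + 1) - w b\<bar> + 1 \<le> q (b + 1)" using K by (simp add: algebra_simps)
  then have "z \<noteq> b + 1" using zb \<open>q b = A\<close> by auto
  have "\<forall>\<^sub>F x in nhds z. x \<in> {a<..<b + 1}"
    using z(1) \<open>z \<noteq> a\<close> \<open>z \<noteq> b + 1\<close> by (intro eventually_nhds_in_open) auto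
  then have "local_max_at (\<lambda>x. w x - q x) z"
    unfolding local_max_at_def by eventually_elim (use z in auto)
  then have "A * (K * exp (K * (z - b))) \<le> 0"
    by (rule test[OF q', rotated]) (intro continuous_intros)
  moreover have "A * (K * exp (K * (z - b))) > 0" using A K by simp
  ultimately show False by simp
qed

lemma viscosity_constant:
  fixes w :: "real \<Rightarrow> real"
  assumes c: "c > 0" and w: "continuous_on UNIV w"
    and max: "\<And>\<psi> \<psi>' z. (\<And>x. (\<psi> has_real_derivative \<psi>' x) (at x)) \<Longrightarrow> continuous_on UNIV \<psi>' \<Longrightarrow>
      local_max_at (\<lambda>x. w x - \<psi> x) z \<Longrightarrow> c * \<psi>' z \<le> 0"
    and min: "\<And>\<psi> \<psi>' z. (\<And>x. (\<psi> has_real_derivative \<psi>' x) (at x)) \<Longrightarrow> continuous_on UNIV \<psi>' \<Longrightarrow>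
      local_min_at (\<lambda>x. w x - \<psi> x) z \<Longrightarrow> 0 \<le> c * \<psi>' z"
  shows "w x = w y"
proof -
  have dec: "w b \<le> w a" if "a \<le> b" for a b
  proof (rule viscosity_nonincreasing[OF w _ that])
    fix \<psi> \<psi>' z assume "\<And>x. (\<psi> has_real_derivative \<psi>' x) (at x)" "continuous_on UNIV \<psi>'" "local_max_at (\<lambda>x. w x - \<psi> x) z"
    from max[OF this] show "\<psi>' z \<le> 0" using c by (simp add: mult_le_0_iff)
  qed
  have inc: "- w b \<le> - w a" if "a \<le> b" for a b
  proof (rule viscosity_nonincreasing[OF _ _ that])
    show "continuous_on UNIV (\<lambda>x. - w x)" using w by (intro continuous_intros)
    fix \<psi> \<psi>' z assume \<psi>: "\<And>x. (\<psi> has_real_derivative \<psi>' x) (at x)" "continuous_on UNIV \<psi>'" "local_max_at (\<lambda>x. - w x - \<psi> x) z"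
    have "local_min_at (\<lambda>x. w x - - \<psi> x) z"
      using \<psi>(3) unfolding local_max_at_def local_min_at_def by eventually_elim auto
    then have "0 \<le> c * (- \<psi>' z)"
      by (rule min[rotated 2]) (use \<psi> in \<open>auto intro!: derivative_eq_intros continuous_intros\<close>)
    then show "\<psi>' z \<le> 0" using c by (simp add: mult_le_0_iff)
  qed
  show ?thesis using dec inc by (metis linear neg_le_iff_le order_antisym)
qed

text \<open>An antiderivative \<open>P\<close> of \<open>f / c\<close> is continuously
  differentiable, so it can be moved between the function and the test function:
  \<open>\<phi> - P\<close> solves \<open>c * w' = 0\<close> in the viscosity sense and is constant.
  For negative \<open>c\<close> the constancy is obtained by reflection.\<close>

lemma viscosity_ode:
  fixes \<phi> f :: "real \<Rightarrow> real"
  assumes c: "c \<noteq> 0" and \<phi>: "continuous_on UNIV \<phi>" and f: "continuous_on UNIV f"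
    and max: "\<And>\<psi> \<psi>' z. (\<And>x. (\<psi> has_real_derivative \<psi>' x) (at x)) \<Longrightarrow> continuous_on UNIV \<psi>' \<Longrightarrow>
      local_max_at (\<lambda>x. \<phi> x - \<psi> x) z \<Longrightarrow> c * \<psi>' z \<le> f z"
    and min: "\<And>\<psi> \<psi>' z. (\<And>x. (\<psi> has_real_derivative \<psi>' x) (at x)) \<Longrightarrow> continuous_on UNIV \<psi>' \<Longrightarrow>
      local_min_at (\<lambda>x. \<phi> x - \<psi> x) z \<Longrightarrow> f z \<le> c * \<psi>' z"
  shows "(\<phi> has_real_derivative f z / c) (at z)"
proof -
  have g: "continuous_on UNIV (\<lambda>x. f x / c)" using f c by (intro continuous_intros) auto
  obtain P where P: "\<And>x. (P has_real_derivative f x / c) (at x)"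
    using einterval_antiderivative[of "-\<infinity>" "\<infinity>" "\<lambda>x. f x / c"] g
    by (auto simp: continuous_on_eq_continuous_at has_real_derivative_iff_has_vector_derivative)
  define w where "w x = \<phi> x - P x" for x
  have contP: "continuous_on UNIV P" using P by (meson DERIV_isCont continuous_at_imp_continuous_on)
  have w: "continuous_on UNIV w" unfolding w_def by (intro continuous_intros \<phi> contP)
  have wmax: "c * \<psi>' z \<le> 0" if "\<And>x. (\<psi> has_real_derivative \<psi>' x) (at x)" "continuous_on UNIV \<psi>'"
    "local_max_at (\<lambda>x. w x - \<psi> x) z" for \<psi> \<psi>' z
  proof -
    have "c * (f z / c + \<psi>' z) \<le> f z"
    proof (rule max)
      show "((\<lambda>x. P x + \<psi> x) has_real_derivative f x / c + \<psi>' x) (at x)" for x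
        by (intro DERIV_add P that)
      show "continuous_on UNIV (\<lambda>x. f x / c + \<psi>' x)" by (intro continuous_on_add g that)
      show "local_max_at (\<lambda>x. \<phi> x - (P x + \<psi> x)) z" using that(3) by (simp add: w_def algebra_simps)
    qed
    then show ?thesis using c by (simp add: algebra_simps)
  qed
  have wmin: "0 \<le> c * \<psi>' z" if "\<And>x. (\<psi> has_real_derivative \<psi>' x) (at x)" "continuous_on UNIV \<psi>'"
    "local_min_at (\<lambda>x. w x - \<psi> x) z" for \<psi> \<psi>' z
  proof -
    have "f z \<le> c * (f z / c + \<psi>' z)"
    proof (rule min)
      show "((\<lambda>x. P x + \<psi> x) has_real_derivative f x / c + \<psi>' x) (at x)" for x
        by (intro DERIV_add P that)
      show "continuous_on UNIV (\<lambda>x. f x / c + \<psi>' x)" by (intro continuous_on_add g that)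
      show "local_min_at (\<lambda>x. \<phi> x - (P x + \<psi> x)) z" using that(3) by (simp add: w_def algebra_simps)
    qed
    then show ?thesis using c by (simp add: algebra_simps)
  qed
  have const: "w x = w y" for x y
  proof (cases "c > 0")
    case True
    show ?thesis
    proof (rule viscosity_constant[OF True w])
      fix \<psi> \<psi>' z assume \<psi>: "\<And>x. (\<psi> has_real_derivative \<psi>' x) (at x)" "continuous_on UNIV \<psi>'"
      show "c * \<psi>' z \<le> 0" if "local_max_at (\<lambda>x. w x - \<psi> x) z" using wmax[OF \<psi> that] .
      show "0 \<le> c * \<psi>' z" if "local_min_at (\<lambda>x. w x - \<psi> x) z" using wmin[OF \<psi> that] .
    qed
  next
    case False
    then have c': "- c > 0" using c by simp
    have "w (- (- x)) = w (- (- y))"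
    proof (rule viscosity_constant[OF c', of "\<lambda>x. w (- x)"])
      show "continuous_on UNIV (\<lambda>x. w (- x))" by (intro continuous_on_compose2[OF w] continuous_intros) auto
      fix \<psi> \<psi>' z assume \<psi>: "\<And>x. (\<psi> has_real_derivative \<psi>' x) (at x)" "continuous_on UNIV \<psi>'"
      note refl = continuous_derivative_reflect[OF \<psi>]
      show "- c * \<psi>' z \<le> 0" if "local_max_at (\<lambda>x. w (- x) - \<psi> x) z"
        using wmax[OF refl, of "- z"] local_max_at_reflect[OF that] by simp
      show "0 \<le> - c * \<psi>' z" if "local_min_at (\<lambda>x. w (- x) - \<psi> x) z"
      proof -
        have "local_max_at (\<lambda>x. - (w (- x) - \<psi> x)) z"
          using that unfolding local_max_at_def local_min_at_def by eventually_elim auto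
        from local_max_at_reflect[OF this]
        have "local_min_at (\<lambda>x. w x - \<psi> (- x)) (- z)"
          unfolding local_max_at_def local_min_at_def by eventually_elim auto
        then show ?thesis using wmin[OF refl, of "- z"] by simp
      qed
    qed
    then show ?thesis by simp
  qed
  have "\<phi> = (\<lambda>x. P x + w z)"
    using const[of _ z] by (auto simp: fun_eq_iff w_def algebra_simps)
  moreover have "((\<lambda>x. P x + w z) has_real_derivative f z / c) (at z)"
    using P[of z] by (auto intro!: derivative_eq_intros)
  ultimately show ?thesis by simp
qed

lemma upper_env_continuous:
  assumes u: "range u \<subseteq> {0..1}" and cont: "continuous_on UNIV u"
  shows "upper_env u = u"
proof
  fix y
  have lim: "(u \<longlongrightarrow> u y) (nhds y)"
    using continuous_on_interior[OF cont, of y] by (simp add: isCont_def tendsto_at_iff_tendsto_nhds)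
  have "upper_env u y \<le> u y + e" if "e > 0" for e
    using order_tendstoD(2)[OF lim, of "u y + e"] that
    by (intro upper_env_le[OF u]) (auto elim!: eventually_mono)
  then show "upper_env u y = u y"
    using upper_env_ge[OF u, of y] by (metis field_le_epsilon order_antisym)
qed

lemma lower_env_continuous:
  assumes u: "range u \<subseteq> {0..1}" and cont: "continuous_on UNIV u"
  shows "lower_env u = u"
proof
  fix y
  have lim: "(u \<longlongrightarrow> u y) (nhds y)"
    using continuous_on_interior[OF cont, of y] by (simp add: isCont_def tendsto_at_iff_tendsto_nhds)
  have "u y \<le> lower_env u y + e" if "e > 0" for e
  proof -
    have "u y - e \<le> lower_env u y"
      using order_tendstoD(1)[OF lim, of "u y - e"] that
      by (intro lower_env_ge[OF u]) (auto elim!: eventually_mono)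
    then show ?thesis by simp
  qed
  then show "lower_env u y = u y"
    using lower_env_le[OF u, of y] by (metis field_le_epsilon order_antisym)
qed

context wave_system begin

definition classical_solution :: "real \<Rightarrow> (real \<Rightarrow> real) \<Rightarrow> (real \<Rightarrow> real) \<Rightarrow> bool" where
  "classical_solution c u1 u2 \<longleftrightarrow>
     (\<forall>z. (u1 has_real_derivative \<alpha> * (u2 z - u1 z) / c) (at z) \<and>
          (u2 has_real_derivative (H (window u1 z) - \<alpha> * u2 z) / c) (at z))"

lemma continuous_H_window:
  assumes "range u \<subseteq> {0..1}" "continuous_on UNIV u"
  shows "continuous_on UNIV (\<lambda>z. H (window u z))"
proof -
  have w: "continuous_on UNIV (window u)"
    unfolding window_def by (intro continuous_intros continuous_on_compose2[OF assms(2)]) auto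
  have "continuous_on UNIV (\<lambda>z. F (window u z))"
    by (intro continuous_on_compose2[OF F_cont w]) (use window_in_cube[OF assms(1)] in auto)
  then show ?thesis unfolding H_def by (intro continuous_intros w)
qed

lemma continuous_wave_classical:
  assumes wave: "continuous_wave \<alpha> r F c \<phi>1 \<phi>2" and c: "c \<noteq> 0"
  shows "classical_solution c \<phi>1 \<phi>2"
proof -
  have rng: "range \<phi>1 \<subseteq> {0..1}" "range \<phi>2 \<subseteq> {0..1}" and cont: "continuous_on UNIV \<phi>1" "continuous_on UNIV \<phi>2"
    and visc: "visc_solution \<alpha> r F c UNIV \<phi>1 \<phi>2"
    using wave by (auto simp: continuous_wave_def travelling_wave_def)
  have sub: "visc_subsolution \<alpha> r F c UNIV \<phi>1 \<phi>2" and super: "visc_supersolution \<alpha> r F c UNIV \<phi>1 \<phi>2"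
    using visc by (auto simp: visc_solution_def upper_env_continuous lower_env_continuous rng cont)
  show ?thesis
    unfolding classical_solution_def
  proof (intro allI conjI)
    fix z
    show "(\<phi>1 has_real_derivative \<alpha> * (\<phi>2 z - \<phi>1 z) / c) (at z)"
    proof (rule viscosity_ode[OF c cont(1)])
      show "continuous_on UNIV (\<lambda>z. \<alpha> * (\<phi>2 z - \<phi>1 z))" by (intro continuous_intros cont)
      fix \<psi> \<psi>' z assume \<psi>: "\<And>x. (\<psi> has_real_derivative \<psi>' x) (at x)" "continuous_on UNIV \<psi>'"
      show "c * \<psi>' z \<le> \<alpha> * (\<phi>2 z - \<phi>1 z)" if "local_max_at (\<lambda>x. \<phi>1 x - \<psi> x) z"
        using subsolutionD(1)[OF sub \<psi> that] .
      show "\<alpha> * (\<phi>2 z - \<phi>1 z) \<le> c * \<psi>' z" if "local_min_at (\<lambda>x. \<phi>1 x - \<psi> x) z"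
        using supersolutionD(1)[OF super \<psi> that] .
    qed
    show "(\<phi>2 has_real_derivative (H (window \<phi>1 z) - \<alpha> * \<phi>2 z) / c) (at z)"
    proof (rule viscosity_ode[OF c cont(2)])
      show "continuous_on UNIV (\<lambda>z. H (window \<phi>1 z) - \<alpha> * \<phi>2 z)"
        by (intro continuous_intros cont continuous_H_window rng)
      fix \<psi> \<psi>' z assume \<psi>: "\<And>x. (\<psi> has_real_derivative \<psi>' x) (at x)" "continuous_on UNIV \<psi>'"
      show "c * \<psi>' z \<le> H (window \<phi>1 z) - \<alpha> * \<phi>2 z" if "local_max_at (\<lambda>x. \<phi>2 x - \<psi> x) z"
        using subsolutionD(2)[OF sub \<psi> that] .
      show "H (window \<phi>1 z) - \<alpha> * \<phi>2 z \<le> c * \<psi>' z" if "local_min_at (\<lambda>x. \<phi>2 x - \<psi> x) z"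
        using supersolutionD(2)[OF super \<psi> that] .
    qed
  qed
qed

lemma classical_solution_continuous:
  assumes "classical_solution c u1 u2"
  shows "continuous_on UNIV u1" "continuous_on UNIV u2"
  using assms unfolding classical_solution_def
  by (meson DERIV_isCont continuous_at_imp_continuous_on)+

lemma classical_solution_shift:
  assumes "classical_solution c u1 u2"
  shows "classical_solution c (\<lambda>x. u1 (x + s)) (\<lambda>x. u2 (x + s))"
proof -
  have "window (\<lambda>x. u1 (x + s)) z = window u1 (z + s)" for z
    by (simp add: vec_eq_iff ac_simps)
  then show ?thesis
    using assms unfolding classical_solution_def by (simp add: DERIV_shift[symmetric])
qed

section \<open>Strong comparison and sliding\<close>

lemma window_mono: "(\<And>x. u x \<le> v x) \<Longrightarrow> window u z \<le> window v z"
  by (simp add: less_eq_vec_def)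

text \<open>At a contact point the difference of the ordered components has a minimum, so its
  derivative vanishes. The first equation thereby passes contact from the first components to the
  second; the second equation gives equality of \<open>H\<close> on the windows, and strictness in
  \<open>X_0\<close> returns contact to the first. It thus suffices to show that the contact set
  \<open>Z\<close> of the second components is the whole line.\<close>

lemma strong_comparison_pos:
  assumes c: "c > 0" and u: "classical_solution c u1 u2" and v: "classical_solution c v1 v2"
    and u_rng: "range u1 \<subseteq> {0..1}" "range u2 \<subseteq> {0..1}" and v_rng: "range v1 \<subseteq> {0..1}" "range v2 \<subseteq> {0..1}"
    and le: "\<And>x. u1 x \<le> v1 x" "\<And>x. u2 x \<le> v2 x"
    and touch: "u1 x0 = v1 x0 \<or> u2 x0 = v2 x0"
    and D: "Dplus_i r \<or> Dplus_ii r F"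
  shows "u1 x = v1 x \<and> u2 x = v2 x"
proof -
  have du1: "(u1 has_real_derivative \<alpha> * (u2 z - u1 z) / c) (at z)"
    and du2: "(u2 has_real_derivative (H (window u1 z) - \<alpha> * u2 z) / c) (at z)" for z
    using u by (auto simp: classical_solution_def)
  have dv1: "(v1 has_real_derivative \<alpha> * (v2 z - v1 z) / c) (at z)"
    and dv2: "(v2 has_real_derivative (H (window v1 z) - \<alpha> * v2 z) / c) (at z)" for z
    using v by (auto simp: classical_solution_def)
  have Hle: "H (window u1 z) \<le> H (window v1 z)" for z
    by (intro H_mono window_in_cube window_mono u_rng v_rng le)
  have touch1: "u2 z = v2 z" if "u1 z = v1 z" for z
  proof -
    have "\<alpha> * (v2 z - v1 z) / c - \<alpha> * (u2 z - u1 z) / c = 0"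
      by (rule DERIV_local_min[OF DERIV_diff[OF dv1 du1] zero_less_one]) (use le that in auto)
    then show ?thesis using c \<alpha>_pos that by (auto simp: field_simps)
  qed
  have touch2: "u1 z = v1 z" and touch2': "H (window u1 z) = H (window v1 z)" if "u2 z = v2 z" for z
  proof -
    have "(H (window v1 z) - \<alpha> * v2 z) / c - (H (window u1 z) - \<alpha> * u2 z) / c = 0"
      by (rule DERIV_local_min[OF DERIV_diff[OF dv2 du2] zero_less_one]) (use le that in auto)
    then show eq: "H (window u1 z) = H (window v1 z)" using c that by (auto simp: field_simps)
    show "u1 z = v1 z"
    proof (rule ccontr)
      assume "u1 z \<noteq> v1 z"
      then have "window u1 z $ 0 < window v1 z $ 0" using le(1)[of z] by (simp add: r0)
      then have "H (window u1 z) < H (window v1 z)"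
        by (intro H_strict window_in_cube window_mono u_rng v_rng le)
      then show False using eq by simp
    qed
  qed
  define Z where "Z = {z. u2 z = v2 z}"
  have x0: "x0 \<in> Z" using touch touch1 by (auto simp: Z_def)
  have Z_down: "y \<in> Z" if z: "z \<in> Z" and "y \<le> z" for y z
  proof -
    \<comment> \<open>The integrating factor removes the damping; what remains of the derivative is
      the non-negative difference of the \<open>H\<close> terms divided by
      \<open>c > 0\<close>.\<close>
    define e where "e t = exp (\<alpha> / c * t) * (v2 t - u2 t)" for t
    have "e y \<le> e z"
    proof (rule DERIV_nonneg_imp_nondecreasing[OF \<open>y \<le> z\<close>])
      fix t
      have "(e has_real_derivative exp (\<alpha> / c * t) * ((H (window v1 t) - H (window u1 t)) / c)) (at t)"
        unfolding e_def using c
        by (auto intro!: derivative_eq_intros du2 dv2 simp: field_simps)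
      moreover have "exp (\<alpha> / c * t) * ((H (window v1 t) - H (window u1 t)) / c) \<ge> 0"
        using Hle[of t] c by simp
      ultimately show "\<exists>d. (e has_real_derivative d) (at t) \<and> 0 \<le> d" by blast
    qed
    also have "e z = 0" using z by (simp add: e_def Z_def)
    finally have "v2 y - u2 y \<le> 0" by (simp add: e_def mult_le_0_iff)
    then show ?thesis using le(2)[of y] by (simp add: Z_def)
  qed
  have "z \<in> Z" for z
    using D
  proof
    assume "Dplus_ii r F"
    then obtain i where i: "r i > 0" and inc: "strictly_increasing_in F i" by (auto simp: Dplus_ii_def)
    then have "i \<noteq> 0" using r0 by auto
    \<comment> \<open>Equality of \<open>H\<close> at \<open>y\<close> rules out a strict gap in
      coordinate \<open>i\<close>. Iterating reaches points of \<open>Z\<close> arbitrarily far to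
      the right, and \<open>Z_down\<close> fills in the rest.\<close>
    have step: "y + r i \<in> Z" if y: "y \<in> Z" for y
    proof -
      let ?U = "window u1 y" and ?V = "window v1 y"
      have UV: "?U \<in> {0..1}" "?V \<in> {0..1}" "?U \<le> ?V"
        by (intro window_in_cube window_mono u_rng v_rng le)+
      have "u1 (y + r i) = v1 (y + r i)"
      proof (rule ccontr)
        assume "u1 (y + r i) \<noteq> v1 (y + r i)"
        then have less: "?U $ i < ?V $ i" using le(1)[of "y + r i"] by simp
        have bounds: "0 \<le> ?U $ i" "0 \<le> ?V $ i" "?V $ i \<le> 1" using unit_rangeD[OF u_rng(1)] unit_rangeD[OF v_rng(1)] by auto
        have "strict_mono_on {0..1} (\<lambda>t. F (vec_upd ?U i t))"
          using inc UV(1) unfolding strictly_increasing_in_def by blast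
        then have "F (vec_upd ?U i (?U $ i)) < F (vec_upd ?U i (?V $ i))"
          using less bounds by (auto simp: strict_mono_on_def)
        then have "H ?U < H (vec_upd ?U i (?V $ i))"
          using \<open>i \<noteq> 0\<close> unfolding vec_upd_same by (simp add: H_def)
        also have "\<dots> \<le> H ?V"
        proof (rule H_mono[OF _ UV(2)])
          have "0 \<le> ?U $ j \<and> ?U $ j \<le> 1 \<and> ?U $ j \<le> ?V $ j" for j
            using unit_rangeD[OF u_rng(1)] le(1) by simp
          then show "vec_upd ?U i (?V $ i) \<in> {0..1}" "vec_upd ?U i (?V $ i) \<le> ?V"
            using bounds less by (auto simp: less_eq_vec_def simp del: window_nth)
        qed
        finally show False using touch2'[of y] y by (simp add: Z_def)
      qed
      then show ?thesis using touch1 by (simp add: Z_def)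
    qed
    have steps: "x0 + real n * r i \<in> Z" for n
    proof (induction n)
      case (Suc n)
      have "x0 + real (Suc n) * r i = x0 + real n * r i + r i" by (simp add: algebra_simps)
      then show ?case using step[OF Suc] by (simp only:)
    qed (use x0 in simp)
    obtain n where "z - x0 < real n * r i" using reals_Archimedean3[OF i] by blast
    then show ?thesis using Z_down[OF steps[of n]] by simp
  next
    \<comment> \<open>A Gronwall argument just beyond the right end \<open>b\<close> of
      \<open>Z\<close>.\<close>
    assume "Dplus_i r"
    then have r_le: "r i \<le> 0" for i by (simp add: Dplus_i_def)
    show ?thesis
    proof (rule ccontr)
      assume "z \<notin> Z"
      have bdd: "bdd_above Z" using Z_down \<open>z \<notin> Z\<close> by (intro bdd_aboveI[of _ z]) (meson linear)
      have cont: "continuous_on UNIV u1" "continuous_on UNIV u2" "continuous_on UNIV v1" "continuous_on UNIV v2"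
        using classical_solution_continuous u v by blast+
      have "closed Z" unfolding Z_def by (intro closed_Collect_eq cont)
      define b where "b = Sup Z"
      have b: "b \<in> Z" unfolding b_def using x0 bdd \<open>closed Z\<close> by (intro closed_contains_Sup) auto
      have b_max: "y \<notin> Z" if "y > b" for y
        using cSup_upper[OF _ bdd, of y] that unfolding b_def by auto
      \<comment> \<open>A growth rate valid for both differences, per unit of their maximum. The
        length \<open>h\<close> satisfies \<open>\<kappa> * h = 1 / 2\<close>, so the maximum
        \<open>M\<close> on the interval is at most \<open>M / 2\<close>.\<close>
      define \<kappa> where "\<kappa> = (L + \<alpha>) / c"
      have \<kappa>: "\<kappa> > 0" "\<alpha> / c \<le> \<kappa>" using L_nonneg \<alpha>_pos c by (auto simp: \<kappa>_def divide_right_mono)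
      define h where "h = 1 / (2 * \<kappa>)"
      have h: "h > 0" "\<kappa> * h = 1 / 2" using \<kappa> by (auto simp: h_def)
      define m where "m t = max (v1 t - u1 t) (v2 t - u2 t)" for t
      have "continuous_on {b..b + h} m"
        unfolding m_def by (intro continuous_intros continuous_on_subset[OF cont(1)] continuous_on_subset[OF cont(2)]
          continuous_on_subset[OF cont(3)] continuous_on_subset[OF cont(4)]) auto
      then obtain t0 where t0: "t0 \<in> {b..b + h}" "\<And>t. t \<in> {b..b + h} \<Longrightarrow> m t \<le> m t0"
        using continuous_attains_sup[of "{b..b + h}" m] h by auto
      define M where "M = m t0"
      have M0: "0 \<le> M" using le(1)[of t0] by (simp add: M_def m_def)
      have M1: "M \<le> 1"
        using unit_rangeD[OF u_rng(1), of t0] unit_rangeD[OF u_rng(2), of t0]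
          unit_rangeD[OF v_rng(1), of t0] unit_rangeD[OF v_rng(2), of t0]
        by (simp add: M_def m_def)
      have zero: "u1 t = v1 t" "u2 t = v2 t" if "t \<le> b" for t
        using Z_down[OF b that] touch2[of t] by (auto simp: Z_def)
      \<comment> \<open>The bound holds on the whole half-line because the waves coincide up to
        \<open>b\<close>; with \<open>r i \<le> 0\<close> it covers every entry of the
        window.\<close>
      have w_le: "v1 t - u1 t \<le> M" "v2 t - u2 t \<le> M" if "t \<le> b + h" for t
      proof -
        have "m t \<le> M"
        proof (cases "t \<le> b")
          case True
          then show ?thesis using zero[of t] M0 by (simp add: m_def)
        next
          case False
          then show ?thesis using t0(2)[of t] that by (simp add: M_def)
        qed
        then show "v1 t - u1 t \<le> M" "v2 t - u2 t \<le> M" by (auto simp: m_def)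
      qed
      have Hd: "H (window v1 t) - H (window u1 t) \<le> (L + \<alpha>) * M" if "t \<le> b + h" for t
      proof -
        have "window v1 t $ i \<le> window u1 t $ i + M" for i
          using w_le(1)[of "t + r i"] r_le[of i] that by simp
        then show ?thesis
          using H_diff_le[OF window_in_cube[OF v_rng(1)] window_in_cube[OF u_rng(1)] M0 M1, of t t] by simp
      qed
      have small: "w t0 \<le> M / 2"
        if w: "\<And>t. (w has_real_derivative w' t) (at t)" and w': "\<And>t. t \<le> b + h \<Longrightarrow> w' t \<le> \<kappa> * M" and "w b = 0"
        for w w' :: "real \<Rightarrow> real"
      proof -
        have "\<kappa> * M * b - w b \<le> \<kappa> * M * t0 - w t0"
        proof (rule DERIV_nonneg_imp_nondecreasing[of b t0 "\<lambda>t. \<kappa> * M * t - w t"])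
          show "b \<le> t0" using t0 by simp
          fix t assume "b \<le> t" "t \<le> t0"
          moreover have "((\<lambda>t. \<kappa> * M * t - w t) has_real_derivative \<kappa> * M - w' t) (at t)"
            by (auto intro!: derivative_eq_intros w)
          ultimately show "\<exists>y. ((\<lambda>t. \<kappa> * M * t - w t) has_real_derivative y) (at t) \<and> 0 \<le> y"
            using w'[of t] t0 by force
        qed
        then have "w t0 \<le> \<kappa> * M * (t0 - b)" using \<open>w b = 0\<close> by (simp add: algebra_simps)
        also have "\<dots> \<le> \<kappa> * M * h" using t0 \<kappa> M0 by (intro mult_left_mono) auto
        also have "\<dots> = M / 2" using h(2) by (simp add: ac_simps)
        finally show ?thesis .
      qed
      have "v1 t0 - u1 t0 \<le> M / 2"
      proof (rule small[OF DERIV_diff[OF dv1 du1]])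
        fix t assume t: "t \<le> b + h"
        have "\<alpha> * (v2 t - v1 t) / c - \<alpha> * (u2 t - u1 t) / c = \<alpha> / c * ((v2 t - u2 t) - (v1 t - u1 t))"
          using c by (simp add: field_simps)
        also have "\<dots> \<le> \<alpha> / c * M" using w_le(2)[OF t] le(1)[of t] \<alpha>_pos c by (intro mult_left_mono) auto
        also have "\<dots> \<le> \<kappa> * M" using \<kappa> M0 by (intro mult_right_mono) auto
        finally show "\<alpha> * (v2 t - v1 t) / c - \<alpha> * (u2 t - u1 t) / c \<le> \<kappa> * M" .
      qed (use zero in auto)
      moreover have "v2 t0 - u2 t0 \<le> M / 2"
      proof (rule small[OF DERIV_diff[OF dv2 du2]])
        fix t assume t: "t \<le> b + h"
        have "(H (window v1 t) - \<alpha> * v2 t) / c - (H (window u1 t) - \<alpha> * u2 t) / c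
            = (H (window v1 t) - H (window u1 t) - \<alpha> * (v2 t - u2 t)) / c"
          using c by (simp add: field_simps)
        also have "\<dots> \<le> ((L + \<alpha>) * M) / c"
        proof -
          have "0 \<le> \<alpha> * (v2 t - u2 t)" using le(2)[of t] \<alpha>_pos by simp
          then show ?thesis using Hd[OF t] c by (intro divide_right_mono) linarith+
        qed
        also have "\<dots> = \<kappa> * M" by (simp add: \<kappa>_def)
        finally show "(H (window v1 t) - \<alpha> * v2 t) / c - (H (window u1 t) - \<alpha> * u2 t) / c \<le> \<kappa> * M" .
      qed (use zero in auto)
      moreover have "M = max (v1 t0 - u1 t0) (v2 t0 - u2 t0)" by (simp add: M_def m_def)
      ultimately have "M \<le> M / 2" by (metis max_def)
      then have "M = 0" using M0 by simp
      then have "b + h \<in> Z" using w_le(2)[of "b + h"] le(2)[of "b + h"] by (simp add: Z_def)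
      then show False using b_max h by simp
    qed
  qed
  then show ?thesis using touch2 by (auto simp: Z_def)
qed

text \<open>Reflection is done at this level because the statement does not mention limits at
  infinity, which would be exchanged. The signs of \<open>c\<close> and of all \<open>r i\<close>
  change, so (D-) turns into (D+).\<close>

lemma strong_comparison:
  assumes c: "c \<noteq> 0" and u: "classical_solution c u1 u2" and v: "classical_solution c v1 v2"
    and rng: "range u1 \<subseteq> {0..1}" "range u2 \<subseteq> {0..1}" "range v1 \<subseteq> {0..1}" "range v2 \<subseteq> {0..1}"
    and le: "\<And>x. u1 x \<le> v1 x" "\<And>x. u2 x \<le> v2 x"
    and touch: "u1 x0 = v1 x0 \<or> u2 x0 = v2 x0"
    and Dp: "c > 0 \<Longrightarrow> Dplus_i r \<or> Dplus_ii r F" and Dm: "c < 0 \<Longrightarrow> Dminus_i r \<or> Dminus_ii r F"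
  shows "u1 x = v1 x \<and> u2 x = v2 x"
proof (cases "c > 0")
  case True
  then show ?thesis using strong_comparison_pos[OF True u v rng le touch Dp[OF True]] by simp
next
  case False
  then have c': "- c > 0" "c < 0" using c by auto
  interpret refl: wave_system where \<alpha> = \<alpha> and L = L and F = F and r = "\<lambda>i. - r i"
    by unfold_locales (simp add: r0)
  have window: "refl.window (\<lambda>x. w (- x)) z = window w (- z)" for w z
    by (simp add: vec_eq_iff refl.window_def)
  have reflect: "refl.classical_solution (- c) (\<lambda>x. w1 (- x)) (\<lambda>x. w2 (- x))"
    if "classical_solution c w1 w2" for w1 w2
    unfolding refl.classical_solution_def window
  proof (intro allI conjI)
    fix z
    have d: "(w1 has_real_derivative \<alpha> * (w2 (- z) - w1 (- z)) / c) (at (- z))"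
      "(w2 has_real_derivative (H (window w1 (- z)) - \<alpha> * w2 (- z)) / c) (at (- z))"
      using that by (auto simp: classical_solution_def)
    have neg: "(uminus has_real_derivative - 1) (at z)" by (auto intro!: derivative_eq_intros)
    show "((\<lambda>x. w1 (- x)) has_real_derivative \<alpha> * (w2 (- z) - w1 (- z)) / - c) (at z)"
      using DERIV_chain2[OF d(1) neg] by simp
    show "((\<lambda>x. w2 (- x)) has_real_derivative (H (window w1 (- z)) - \<alpha> * w2 (- z)) / - c) (at z)"
      using DERIV_chain2[OF d(2) neg] by simp
  qed
  have D: "Dplus_i (\<lambda>i. - r i) \<or> Dplus_ii (\<lambda>i. - r i) F"
    using Dm[OF c'(2)] by (auto simp: Dplus_i_def Dplus_ii_def Dminus_i_def Dminus_ii_def)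
  have rng': "range (\<lambda>x. w (- x)) \<subseteq> {0..1}" if "range w \<subseteq> {0..1}" for w :: "real \<Rightarrow> real"
    using that by auto
  have "u1 (- (- x)) = v1 (- (- x)) \<and> u2 (- (- x)) = v2 (- (- x))"
    by (rule refl.strong_comparison_pos[OF c'(1) reflect[OF u] reflect[OF v] rng'[OF rng(1)] rng'[OF rng(2)]
          rng'[OF rng(3)] rng'[OF rng(4)], of "- x0"]) (use le touch D in auto)
  then show ?thesis by simp
qed

end

section \<open>Sliding one wave over another: contact, uniqueness and monotonicity\<close>

lemma compose_shift_at_top: "(f \<longlongrightarrow> (l::real)) at_top \<Longrightarrow> ((\<lambda>x. f (x + s)) \<longlongrightarrow> l) at_top" for s :: real
  by (rule filterlim_compose[OF _ filterlim_tendsto_add_at_top[OF tendsto_const[of s] filterlim_ident, unfolded add.commute[of s]]])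

lemma compose_shift_at_bot: "(f \<longlongrightarrow> (l::real)) at_bot \<Longrightarrow> ((\<lambda>x. f (x + s)) \<longlongrightarrow> l) at_bot" for s :: real
  by (rule filterlim_compose[of _ _ at_bot])
     (auto simp: filterlim_at_bot eventually_at_bot_linorder le_diff_eq[symmetric])

lemma front_not_periodic:
  fixes \<phi> :: "real \<Rightarrow> real"
  assumes lim: "(\<phi> \<longlongrightarrow> 0) at_bot" "(\<phi> \<longlongrightarrow> 1) at_top" and per: "\<And>x. \<phi> x = \<phi> (x + s)"
  shows "s = 0"
proof (rule ccontr)
  assume "s \<noteq> 0"
  have per': "\<phi> x = \<phi> (x + \<bar>s\<bar>)" for x
    using per[of x] per[of "x - s"] by (cases "s \<ge> 0") (auto simp: abs_if)
  have pern: "\<phi> x = \<phi> (x + real n * \<bar>s\<bar>)" for x n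
  proof (induction n)
    case (Suc n)
    have "x + real (Suc n) * \<bar>s\<bar> = x + real n * \<bar>s\<bar> + \<bar>s\<bar>" by (simp add: algebra_simps)
    then show ?case using Suc per'[of "x + real n * \<bar>s\<bar>"] by (simp only:)
  qed simp
  obtain x where x: "\<phi> x < 1 / 2"
    using order_tendstoD(2)[OF lim(1), of "1/2"] by (auto simp: eventually_at_bot_linorder)
  obtain N where N: "\<And>y. y \<ge> N \<Longrightarrow> 1 / 2 < \<phi> y"
    using order_tendstoD(1)[OF lim(2), of "1/2"] by (auto simp: eventually_at_top_linorder)
  obtain n where "N - x < real n * \<bar>s\<bar>" using reals_Archimedean3[of "\<bar>s\<bar>"] \<open>s \<noteq> 0\<close> by auto
  then have "1 / 2 < \<phi> (x + real n * \<bar>s\<bar>)" by (intro N) simp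
  then show False using pern[of x n] x by simp
qed

context wave_system begin

definition classical_wave :: "real \<Rightarrow> (real \<Rightarrow> real) \<Rightarrow> (real \<Rightarrow> real) \<Rightarrow> bool" where
  "classical_wave c u1 u2 \<longleftrightarrow> classical_solution c u1 u2 \<and> range u1 \<subseteq> {0..1} \<and> range u2 \<subseteq> {0..1} \<and>
     (u1 \<longlongrightarrow> 0) at_bot \<and> (u1 \<longlongrightarrow> 1) at_top \<and> (u2 \<longlongrightarrow> 0) at_bot \<and> (u2 \<longlongrightarrow> 1) at_top"

lemma classical_wave_shift:
  assumes "classical_wave c u1 u2"
  shows "classical_wave c (\<lambda>x. u1 (x + s)) (\<lambda>x. u2 (x + s))"
  using assms unfolding classical_wave_def
  by (auto intro!: classical_solution_shift compose_shift_at_top compose_shift_at_bot)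

definition excess :: "(real \<Rightarrow> real) \<Rightarrow> (real \<Rightarrow> real) \<Rightarrow> (real \<Rightarrow> real) \<Rightarrow> (real \<Rightarrow> real) \<Rightarrow> real \<Rightarrow> real \<Rightarrow> real" where
  "excess u1 u2 v1 v2 s x = max (u1 x - v1 (x + s)) (u2 x - v2 (x + s))"

text \<open>A positive excess attains its maximum \<open>d\<close>, since it tends to 0 at both
  ends. There the second equations, subtracted, make the \<open>H\<close> values differ by exactly
  \<open>\<alpha> * d\<close>, which (C) excludes in the tails. The bound \<open>R\<close> does not
  depend on the shift \<open>s\<close>; this uniformity is what sliding relies on.\<close>

lemma excess_positive_localized:
  assumes C: "assumption_C F" and c: "c \<noteq> 0" and u: "classical_wave c u1 u2" and v: "classical_wave c v1 v2"
  obtains R where "\<And>s x0. excess u1 u2 v1 v2 s x0 > 0 \<Longrightarrow>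
      \<exists>x. - R \<le> x \<and> x + s \<le> R \<and> excess u1 u2 v1 v2 s x > 0"
proof -
  have u': "classical_solution c u1 u2" "range u1 \<subseteq> {0..1}" "range u2 \<subseteq> {0..1}" "(u1 \<longlongrightarrow> 0) at_bot" "(u2 \<longlongrightarrow> 0) at_bot"
    "(u1 \<longlongrightarrow> 1) at_top" "(u2 \<longlongrightarrow> 1) at_top"
    using u by (auto simp: classical_wave_def)
  have v': "classical_solution c v1 v2" "range v1 \<subseteq> {0..1}" "range v2 \<subseteq> {0..1}" "(v1 \<longlongrightarrow> 0) at_bot" "(v2 \<longlongrightarrow> 0) at_bot"
    "(v1 \<longlongrightarrow> 1) at_top" "(v2 \<longlongrightarrow> 1) at_top"
    using v by (auto simp: classical_wave_def)
  obtain R where R: "\<forall>x y. x \<le> - R \<or> R \<le> y \<longrightarrow> v2 y < u2 x \<longrightarrow>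
      (\<forall>i. u1 (x + r i) \<le> v1 (y + r i) + (u2 x - v2 y)) \<longrightarrow>
      H (window u1 x) < H (window v1 y) + \<alpha> * (u2 x - v2 y)"
    by (rule tail_comparison[OF C u'(2,3,4,5) v'(2,3,6,7)])
  show ?thesis
  proof (rule that)
    fix s x0 assume pos: "excess u1 u2 v1 v2 s x0 > 0"
    let ?f = "excess u1 u2 v1 v2 s"
    have sh: "classical_solution c (\<lambda>x. v1 (x + s)) (\<lambda>x. v2 (x + s))" by (rule classical_solution_shift[OF v'(1)])
    have contf: "continuous_on UNIV ?f"
      unfolding excess_def by (intro continuous_intros classical_solution_continuous[OF u'(1)] classical_solution_continuous[OF sh])
    have lim_bot: "(?f \<longlongrightarrow> max (0 - 0) (0 - 0)) at_bot" and lim_top: "(?f \<longlongrightarrow> max (1 - 1) (1 - 1)) at_top"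
      unfolding excess_def by (intro tendsto_max tendsto_diff u' v' compose_shift_at_bot compose_shift_at_top)+
    obtain N1 where N1: "\<And>x. x \<le> N1 \<Longrightarrow> ?f x < ?f x0"
      using order_tendstoD(2)[OF lim_bot, of "?f x0"] pos by (auto simp: eventually_at_bot_linorder)
    obtain N2 where N2: "\<And>x. x \<ge> N2 \<Longrightarrow> ?f x < ?f x0"
      using order_tendstoD(2)[OF lim_top, of "?f x0"] pos by (auto simp: eventually_at_top_linorder)
    have "\<exists>x. \<forall>y. ?f y \<le> ?f x"
    proof (rule usc_attains_max[where ?z0.0 = x0])
      fix z b assume "?f z < b"
      moreover have "(?f \<longlongrightarrow> ?f z) (nhds z)"
        using continuous_on_interior[OF contf, of z] by (simp add: isCont_def tendsto_at_iff_tendsto_nhds)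
      ultimately show "\<forall>\<^sub>F w in nhds z. ?f w < b" by (rule order_tendstoD(2)[rotated])
    next
      have "{z. ?f x0 \<le> ?f z} \<subseteq> {N1..N2}"
        using N1 N2 by (force simp: not_le[symmetric] intro: ccontr)
      then show "bounded {z. ?f x0 \<le> ?f z}" by (rule bounded_subset[OF bounded_closed_interval])
    qed
    then obtain x where max: "\<And>y. ?f y \<le> ?f x" by blast
    define d where "d = ?f x"
    have d: "d > 0" using max[of x0] pos by (simp add: d_def)
    have le: "u1 y - v1 (y + s) \<le> d" "u2 y - v2 (y + s) \<le> d" for y
      using max[of y] by (auto simp: d_def excess_def)
    have deriv: "(u1 has_real_derivative \<alpha> * (u2 x - u1 x) / c) (at x)"
      "(u2 has_real_derivative (H (window u1 x) - \<alpha> * u2 x) / c) (at x)"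
      "((\<lambda>x. v1 (x + s)) has_real_derivative \<alpha> * (v2 (x + s) - v1 (x + s)) / c) (at x)"
      "((\<lambda>x. v2 (x + s)) has_real_derivative (H (window v1 (x + s)) - \<alpha> * v2 (x + s)) / c) (at x)"
      using u'(1) v'(1) by (auto simp: classical_solution_def DERIV_shift[symmetric])
    \<comment> \<open>If the first components attain the maximum, the vanishing derivative in the
      first equation makes the second components attain it too.\<close>
    have second: "u2 x - v2 (x + s) = d"
    proof (cases "u2 x - v2 (x + s) = d")
      case False
      then have first: "u1 x - v1 (x + s) = d" using le[of x] by (auto simp: d_def excess_def max_def split: if_splits)
      have "\<alpha> * (u2 x - u1 x) / c - \<alpha> * (v2 (x + s) - v1 (x + s)) / c = 0"
        by (rule DERIV_local_max[OF DERIV_diff[OF deriv(1,3)] zero_less_one]) (use le first in auto)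
      then have "\<alpha> * ((u2 x - u1 x) - (v2 (x + s) - v1 (x + s))) / c = 0"
        by (simp add: diff_divide_distrib right_diff_distrib)
      then have "\<alpha> * ((u2 x - u1 x) - (v2 (x + s) - v1 (x + s))) = 0" using c by simp
      then show ?thesis using \<alpha>_pos first by simp
    qed
    have "(H (window u1 x) - \<alpha> * u2 x) / c - (H (window v1 (x + s)) - \<alpha> * v2 (x + s)) / c = 0"
      by (rule DERIV_local_max[OF DERIV_diff[OF deriv(2,4)] zero_less_one]) (use le second in auto)
    then have "H (window u1 x) - \<alpha> * u2 x = H (window v1 (x + s)) - \<alpha> * v2 (x + s)" using c by simp
    then have "H (window u1 x) - H (window v1 (x + s)) = \<alpha> * d"
      by (simp add: second[symmetric] algebra_simps)
    moreover have "u1 (x + r i) \<le> v1 (x + s + r i) + d" for i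
      using le(1)[of "x + r i"] by (simp add: ac_simps)
    ultimately have "\<not> (x \<le> - R \<or> R \<le> x + s)"
      using R[rule_format, of x "x + s"] second d by auto
    then show "\<exists>x. - R \<le> x \<and> x + s \<le> R \<and> ?f x > 0" using d by (intro exI[of _ x]) (simp add: d_def)
  qed
qed

text \<open>The critical shift is the supremum of the shifts with a positive excess somewhere.
  Localization gives \<open>- R \<le> x\<close> and \<open>x + s \<le> R\<close>, hence the bound
  \<open>2 * R\<close> for such shifts. Along shifts converging to the supremum, the points of
  positive excess stay in a compact set, and a limit point is a contact point.\<close>

lemma sliding:
  assumes C: "assumption_C F" and c: "c \<noteq> 0" and u: "classical_wave c u1 u2" and v: "classical_wave c v1 v2"
  obtains s where "\<And>t x. s \<le> t \<Longrightarrow> u1 x \<le> v1 (x + t)" "\<And>t x. s \<le> t \<Longrightarrow> u2 x \<le> v2 (x + t)"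
    "\<exists>x. u1 x = v1 (x + s) \<or> u2 x = v2 (x + s)"
proof -
  let ?G = "excess u1 u2 v1 v2"
  obtain R where R: "\<And>s x0. ?G s x0 > 0 \<Longrightarrow> \<exists>x. - R \<le> x \<and> x + s \<le> R \<and> ?G s x > 0"
    using excess_positive_localized[OF C c u v] by metis
  have cont: "continuous_on UNIV u1" "continuous_on UNIV u2" "continuous_on UNIV v1" "continuous_on UNIV v2"
    using u v classical_solution_continuous by (auto simp: classical_wave_def)
  have contG: "continuous_on UNIV (\<lambda>p. ?G (fst p) (snd p))"
    unfolding excess_def
    by (intro continuous_intros continuous_on_compose2[OF cont(1)] continuous_on_compose2[OF cont(2)]
        continuous_on_compose2[OF cont(3)] continuous_on_compose2[OF cont(4)]) auto
  define B where "B = {s. \<exists>x. ?G s x > 0}"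
  have lim: "(u1 \<longlongrightarrow> 1) at_top" "(v1 \<longlongrightarrow> 0) at_bot" using u v by (auto simp: classical_wave_def)
  obtain a where a: "1 / 2 < u1 a"
    using order_tendstoD(1)[OF lim(1), of "1/2"] by (auto simp: eventually_at_top_linorder)
  obtain b where b: "v1 b < 1 / 2"
    using order_tendstoD(2)[OF lim(2), of "1/2"] by (auto simp: eventually_at_bot_linorder)
  have "?G (b - a) a > 0" using a b by (auto simp: excess_def less_max_iff_disj)
  then have B_ne: "B \<noteq> {}" by (auto simp: B_def)
  have B_bdd: "bdd_above B"
  proof (rule bdd_aboveI)
    fix s assume "s \<in> B"
    then obtain x where "- R \<le> x" "x + s \<le> R" using R unfolding B_def by blast
    then show "s \<le> 2 * R" by linarith
  qed
  define s where "s = Sup B"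
  have above: "?G t x \<le> 0" if "s < t" for t x
    using that cSup_upper[OF _ B_bdd, of t] unfolding s_def B_def by (force simp: not_less[symmetric])
  have at_s: "?G s x \<le> 0" for x
  proof (rule tendsto_upperbound)
    have "continuous_on UNIV (\<lambda>t. ?G t x)"
      using continuous_on_compose2[OF contG, of UNIV "\<lambda>t. (t, x)"] by (simp add: continuous_intros)
    then show "((\<lambda>t. ?G t x) \<longlongrightarrow> ?G s x) (at_right s)"
      by (simp add: continuous_on_eq_continuous_at isCont_def filterlim_at_split)
    show "\<forall>\<^sub>F t in at_right s. ?G t x \<le> 0"
      using eventually_at_right_less[of s] by eventually_elim (rule above)
  qed simp
  have le: "?G t x \<le> 0" if "s \<le> t" for t x using at_s above that by (cases "s = t") auto
  have "s \<in> closure B" unfolding s_def by (rule closure_contains_Sup[OF B_ne B_bdd])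
  then obtain sn where sn: "\<And>n. sn n \<in> B" "sn \<longlonglongrightarrow> s" unfolding closure_sequential by blast
  have "\<exists>x. - R \<le> x \<and> x + sn n \<le> R \<and> ?G (sn n) x > 0" for n
    using sn(1)[of n] R unfolding B_def by blast
  then obtain xn where xn: "\<And>n. - R \<le> xn n" "\<And>n. xn n + sn n \<le> R" "\<And>n. ?G (sn n) (xn n) > 0"
    by metis
  obtain m where m: "\<And>n. norm (sn n) \<le> m" using convergent_imp_Bseq[of sn] sn(2) by (auto simp: convergent_def Bseq_def)
  have "xn n \<in> {- R..R + m}" for n using xn(1,2)[of n] m[of n] by auto
  then obtain x \<rho> where x: "strict_mono \<rho>" "(xn \<circ> \<rho>) \<longlonglongrightarrow> x"
    using compact_Icc[of "- R" "R + m"] unfolding compact_def by metis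
  have "(\<lambda>n. ((sn \<circ> \<rho>) n, (xn \<circ> \<rho>) n)) \<longlonglongrightarrow> (s, x)"
    by (intro tendsto_Pair x(2) LIMSEQ_subseq_LIMSEQ[OF sn(2) x(1)])
  then have "(\<lambda>n. ?G (fst ((sn \<circ> \<rho>) n, (xn \<circ> \<rho>) n)) (snd ((sn \<circ> \<rho>) n, (xn \<circ> \<rho>) n))) \<longlonglongrightarrow> ?G (fst (s, x)) (snd (s, x))"
    by (rule continuous_on_tendsto_compose[OF contG]) auto
  then have "0 \<le> ?G s x"
    by (intro tendsto_lowerbound[where F = sequentially]) (auto intro!: always_eventually less_imp_le xn(3))
  then have "?G s x = 0" using at_s[of x] by simp
  then have "\<exists>x. u1 x = v1 (x + s) \<or> u2 x = v2 (x + s)"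
    by (auto simp: excess_def max_def split: if_splits)
  moreover have "u1 x \<le> v1 (x + t)" "u2 x \<le> v2 (x + t)" if "s \<le> t" for t x
    using le[OF that, of x] by (auto simp: excess_def)
  ultimately show ?thesis using that by blast
qed

text \<open>Strong comparison turns the contact at the critical shift into equality. The ordering
  for all larger shifts is passed on because it yields monotonicity when a wave is slid over
  itself.\<close>

lemma wave_unique_up_to_shift:
  assumes C: "assumption_C F" and c: "c \<noteq> 0" and u: "classical_wave c u1 u2" and v: "classical_wave c v1 v2"
    and Dp: "c > 0 \<Longrightarrow> Dplus_i r \<or> Dplus_ii r F" and Dm: "c < 0 \<Longrightarrow> Dminus_i r \<or> Dminus_ii r F"
  obtains s where "\<And>t x. s \<le> t \<Longrightarrow> u1 x \<le> v1 (x + t)" "\<And>t x. s \<le> t \<Longrightarrow> u2 x \<le> v2 (x + t)"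
    "\<And>x. u1 x = v1 (x + s) \<and> u2 x = v2 (x + s)"
proof -
  obtain s where le: "\<And>t x. s \<le> t \<Longrightarrow> u1 x \<le> v1 (x + t)" "\<And>t x. s \<le> t \<Longrightarrow> u2 x \<le> v2 (x + t)"
    and "\<exists>x. u1 x = v1 (x + s) \<or> u2 x = v2 (x + s)"
    using sliding[OF C c u v] by metis
  then obtain x0 where touch: "u1 x0 = v1 (x0 + s) \<or> u2 x0 = v2 (x0 + s)" by blast
  have vs: "classical_wave c (\<lambda>x. v1 (x + s)) (\<lambda>x. v2 (x + s))" by (rule classical_wave_shift[OF v])
  have "u1 x = v1 (x + s) \<and> u2 x = v2 (x + s)" for x
    using u vs Dp Dm le touch unfolding classical_wave_def
    by (intro strong_comparison[OF c, of u1 u2 "\<lambda>x. v1 (x + s)" "\<lambda>x. v2 (x + s)" x0]) auto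
  then show ?thesis using that le by blast
qed

text \<open>Sliding the wave over itself, the critical shift is a period and therefore 0, so every
  shift \<open>t > 0\<close> is ordered. Contact at such a shift would make \<open>t\<close> a
  period by strong comparison, which the limits 0 and 1 forbid.\<close>

lemma wave_strict_mono:
  assumes C: "assumption_C F" and c: "c \<noteq> 0" and u: "classical_wave c u1 u2"
    and Dp: "c > 0 \<Longrightarrow> Dplus_i r \<or> Dplus_ii r F" and Dm: "c < 0 \<Longrightarrow> Dminus_i r \<or> Dminus_ii r F"
  shows "strict_mono u1 \<and> strict_mono u2"
proof -
  have lim: "(u1 \<longlongrightarrow> 0) at_bot" "(u1 \<longlongrightarrow> 1) at_top" using u by (auto simp: classical_wave_def)
  obtain s where s: "\<And>t x. s \<le> t \<Longrightarrow> u1 x \<le> u1 (x + t)" "\<And>t x. s \<le> t \<Longrightarrow> u2 x \<le> u2 (x + t)"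
    and per: "\<And>x. u1 x = u1 (x + s) \<and> u2 x = u2 (x + s)"
    using wave_unique_up_to_shift[OF C c u u Dp Dm] by metis
  have "s = 0" using front_not_periodic[OF lim] per by blast
  have "u1 x \<noteq> u1 (x + t) \<and> u2 x \<noteq> u2 (x + t)" if "t > 0" for x t
  proof (rule ccontr)
    assume "\<not> ?thesis"
    then have touch: "u1 x = u1 (x + t) \<or> u2 x = u2 (x + t)" by blast
    have ut: "classical_wave c (\<lambda>x. u1 (x + t)) (\<lambda>x. u2 (x + t))" by (rule classical_wave_shift[OF u])
    have "u1 y = u1 (y + t) \<and> u2 y = u2 (y + t)" for y
      using u ut Dp Dm s \<open>s = 0\<close> \<open>t > 0\<close> touch unfolding classical_wave_def
      by (intro strong_comparison[OF c, of u1 u2 "\<lambda>x. u1 (x + t)" "\<lambda>x. u2 (x + t)" x]) auto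
    then show False using front_not_periodic[OF lim] \<open>t > 0\<close> by blast
  qed
  then have "u1 x < u1 (x + t) \<and> u2 x < u2 (x + t)" if "t > 0" for x t
    using s[of t x] \<open>s = 0\<close> that by (simp add: order_less_le)
  then have "u1 x < u1 y \<and> u2 x < u2 y" if "x < y" for x y
    using that by (metis add.commute diff_add_cancel diff_gt_0_iff_gt)
  then show ?thesis by (simp add: strict_mono_def)
qed

lemma continuous_wave_imp_classical_wave:
  assumes "continuous_wave \<alpha> r F c \<phi>1 \<phi>2" "c \<noteq> 0"
  shows "classical_wave c \<phi>1 \<phi>2"
  using assms continuous_wave_classical[OF assms]
  by (simp add: classical_wave_def continuous_wave_def travelling_wave_def)

end

theorem theorem1p3:
  fixes \<alpha>\<^sub>0 :: real and N :: nat
    and r :: "'n::{finite,zero} \<Rightarrow> real"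
    and F :: "real ^ 'n::{finite,zero} \<Rightarrow> real"
  assumes "\<alpha>\<^sub>0 > 0"
    and "N \<ge> 1" and "CARD('n) = N + 1"
    and "r 0 = 0" and "Max (range (\<lambda>i. \<bar>r i\<bar>)) > 0"
    and "assumption_A \<alpha>\<^sub>0 F"
  shows "(assumption_C F \<longrightarrow>
           (\<forall>c c' \<phi>1 \<phi>2 \<phi>1' \<phi>2'.
              travelling_wave \<alpha>\<^sub>0 r F c \<phi>1 \<phi>2 \<and> travelling_wave \<alpha>\<^sub>0 r F c' \<phi>1' \<phi>2' \<longrightarrow> c = c'))
       \<and> (\<forall>c \<phi>1 \<phi>2.
            continuous_wave \<alpha>\<^sub>0 r F c \<phi>1 \<phi>2 \<and> c \<noteq> 0 \<and> assumption_C F \<and>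
            (c > 0 \<longrightarrow> Dplus_i r \<or> Dplus_ii r F) \<and>
            (c < 0 \<longrightarrow> Dminus_i r \<or> Dminus_ii r F) \<longrightarrow>
            (\<forall>\<phi>1' \<phi>2'. continuous_wave \<alpha>\<^sub>0 r F c \<phi>1' \<phi>2' \<longrightarrow>
               (\<exists>a. \<forall>z. \<phi>1' z = \<phi>1 (z + a) \<and> \<phi>2' z = \<phi>2 (z + a))) \<and>
            strict_mono \<phi>1 \<and> strict_mono \<phi>2)"
proof -
  obtain L where L: "wave_nonlinearity \<alpha>\<^sub>0 L F"
    using wave_nonlinearityI assms by blast
  define H where "H \<equiv> \<lambda>X. 2 * F X + \<alpha>\<^sub>0 * X $ 0"
  interpret wave_nonlinearity \<alpha>\<^sub>0 L F H
    by (rule L) (rule H_def)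
  interpret wave_system where \<alpha> = \<alpha>\<^sub>0 and L = L and F = F and H = H and r = r
    by unfold_locales (rule assms)
  show ?thesis
  proof (intro conjI impI allI; (elim conjE)?)
    fix c c' \<phi>1 \<phi>2 \<phi>1' \<phi>2'
    assume "assumption_C F" "travelling_wave \<alpha>\<^sub>0 r F c \<phi>1 \<phi>2" "travelling_wave \<alpha>\<^sub>0 r F c' \<phi>1' \<phi>2'"
    then show "c = c'" using travelling_wave_speed_le by (meson order_antisym)
  next
    fix c \<phi>1 \<phi>2
    assume wave: "continuous_wave \<alpha>\<^sub>0 r F c \<phi>1 \<phi>2" and c: "c \<noteq> 0" and C: "assumption_C F"
      and Dp: "c > 0 \<longrightarrow> Dplus_i r \<or> Dplus_ii r F" and Dm: "c < 0 \<longrightarrow> Dminus_i r \<or> Dminus_ii r F"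
    note \<phi> = continuous_wave_imp_classical_wave[OF wave c]
    show "strict_mono \<phi>1" "strict_mono \<phi>2"
      using wave_strict_mono[OF C c \<phi>] Dp Dm by blast+
    fix \<phi>1' \<phi>2' assume "continuous_wave \<alpha>\<^sub>0 r F c \<phi>1' \<phi>2'"
    from continuous_wave_imp_classical_wave[OF this c]
    show "\<exists>a. \<forall>z. \<phi>1' z = \<phi>1 (z + a) \<and> \<phi>2' z = \<phi>2 (z + a)"
      \<comment> \<open>The other wave takes the first role and the given one the second, so the
        translation falls on the given wave as stated.\<close>
      using wave_unique_up_to_shift[OF C c _ \<phi>] Dp Dm by metis
  qed
qed

end
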